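(* Let $C>0$, $p>1$ (with $p=\infty$ allowed), and $0<\varepsilon<1$. Set $$N=(6/\varepsilon)^{\max\{2,\,p/(p-1)\}}\qquad\text{and}\qquad \eta=4^{-N-1}(\varepsilon/160)^{p/(p-1)} .$$ Let $W:[0,1]^2\to\mathbb{R}$ be a $(C,\eta)$-upper $L^p$ regular graphon. Then there exists a partition $\mathcal{P}$ of $[0,1]$ into at most $4^N$ measurable parts, each having measure at least $\eta$, such that $$\|W-W_{\mathcal{P}}\|_\square\le C\varepsilon .$$
   Context: A graphon is a symmetric (Borel) measurable integrable function $W:[0,1]^2\to\mathbb{R}$; $\|W\|_p$ is the $L^p$ norm with respect to Lebesgue measure $\lambda$ on $[0,1]^2$. The cut norm is $\|W\|_\square=\sup_{S,T\subseteq[0,1]\text{ measurable}}\left|\int_{S\times T}W\,d\lambda\right|$. For a partition $\mathcal{P}=\{J_1,\dots,J_m\}$ of $[0,1]$ into measurable sets, $W_{\mathcal{P}}(x,y)=\frac{1}{\lambda(J_i)\lambda(J_j)}\int_{J_i\times J_j}W\,d\lambda$ for $(x,y)\in J_i\times J_j$. A graphon $W$ is $(C,\eta)$-upper $L^p$ regular if $\|W_{\mathcal{P}}\|_p\le C$ for every partition $\mathcal{P}$ of $[0,1]$ into measurable sets each of measure at least $\eta$. If $p=\infty$, $p/(p-1)$ is read as $1$. *)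

theory Defs
  imports "HOL-Analysis.Analysis" "HOL-Probability.Essential_Supremum"
begin

abbreviation unit_square :: "(real \<times> real) set" where
  "unit_square \<equiv> {0..1} \<times> {0..1}"

(* Graphons are represented by functions on the whole plane; only the values on the
   unit square matter. Integrability with respect to lborel of the product with the
   indicator of the square includes Borel measurability on the square. *)
definition graphon :: "(real \<times> real \<Rightarrow> real) \<Rightarrow> bool" where
  "graphon W \<longleftrightarrow>
     set_integrable lborel unit_square W \<and>
     (\<forall>x\<in>{0..1}. \<forall>y\<in>{0..1}. W (x, y) = W (y, x))"

(* The values are extended because the norm may be infinite; the case split on the
   integral is only there because powr is not available on ennreal. *)
definition Lp_norm :: "'a measure \<Rightarrow> ennreal \<Rightarrow> ('a \<Rightarrow> real) \<Rightarrow> ennreal" where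
  "Lp_norm M p f =
     (if p = \<infinity> then esssup M (\<lambda>x. ennreal \<bar>f x\<bar>)
      else let I = (\<integral>\<^sup>+ x. ennreal (\<bar>f x\<bar> powr enn2real p) \<partial>M)
           in if I = \<infinity> then \<infinity> else ennreal (enn2real I powr (1 / enn2real p)))"

definition conjugate_exponent :: "ennreal \<Rightarrow> real" where
  "conjugate_exponent p = (if p = \<infinity> then 1 else enn2real p / (enn2real p - 1))"

(* For a graphon the supremum is over a set bounded by the integral of the absolute value. *)
definition cut_norm :: "(real \<times> real \<Rightarrow> real) \<Rightarrow> real" where
  "cut_norm W =
     (SUP (S, T) \<in> {S \<in> sets borel. S \<subseteq> {0..1}} \<times> {T \<in> sets borel. T \<subseteq> {0..1}}.
        \<bar>LINT z:(S \<times> T)|lborel. W z\<bar>)"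

definition measurable_partition :: "real set set \<Rightarrow> bool" where
  "measurable_partition P \<longleftrightarrow>
     finite P \<and> partition_on {0..1} P \<and> (\<forall>J\<in>P. J \<in> sets borel)"

(* The blocks of a partition are disjoint, so at a point of the unit square exactly one
   summand has a nonzero indicator. A block with a null side gets the value 0. *)
definition stepping :: "real set set \<Rightarrow> (real \<times> real \<Rightarrow> real) \<Rightarrow> real \<times> real \<Rightarrow> real" where
  "stepping P W z =
     (\<Sum>I\<in>P. \<Sum>J\<in>P. indicator (I \<times> J) z *
        (1 / (measure lborel I * measure lborel J) * (LINT w:(I \<times> J)|lborel. W w)))"

definition upper_Lp_regular :: "real \<Rightarrow> real \<Rightarrow> ennreal \<Rightarrow> (real \<times> real \<Rightarrow> real) \<Rightarrow> bool" where
  "upper_Lp_regular C \<eta> p W \<longleftrightarrow>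
     (\<forall>P. measurable_partition P \<and> (\<forall>J\<in>P. \<eta> \<le> measure lborel J) \<longrightarrow>
        Lp_norm (restrict_space lborel unit_square) p (stepping P W) \<le> ennreal C)"

end

theory Submission
  imports Defs "HOL-Probability.Probability_Measure"
begin

text \<open>
  Suppose no admissible partition works. Starting from the trivial partition, each partition P with
  at most 4 to the N parts has a rectangle on which W minus its average over P integrates to more than
  C times epsilon. Its sides need not cut the parts of P into pieces of measure at least eta, but
  regularity controls the integral of W over thin rectangles (a thin set is a difference of two sets
  of admissible measure), so the sides can be rounded to sets that do, at the cost of half of the
  deviation. Iterating yields a chain of more than N successive refinements.

  For each step of the chain, take the signed difference between the indicator of the rounded
  rectangle and its average over the current partition. These functions are bounded by 1 and pairwise
  orthogonal, and each has correlation at least half of C times epsilon with the average of W over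
  the last partition. This average has its p-norm bounded by C: truncating it at a suitable height
  leaves a part that is small in the 1-norm and a part of controlled 2-norm, so the correlations
  bound the length of the chain by N / 2.
\<close>

subsection \<open>Block averages\<close>

abbreviation square_measure :: "(real \<times> real) measure" where
  "square_measure \<equiv> restrict_space lborel unit_square"

definition fine_partition :: "real \<Rightarrow> real set set \<Rightarrow> bool" where
  "fine_partition \<eta> P \<longleftrightarrow> measurable_partition P \<and> (\<forall>J\<in>P. \<eta> \<le> measure lborel J)"

text \<open>Stands in for measurability with respect to the finite sigma-algebra generated by the
  blocks; when all parts have positive measure, \<open>stepping P\<close> is the conditional
  expectation onto it.\<close>

definition blockwise_constant :: "real set set \<Rightarrow> (real \<times> real \<Rightarrow> real) \<Rightarrow> bool" where
  "blockwise_constant P h \<longleftrightarrow> (\<forall>I\<in>P. \<forall>J\<in>P. \<exists>c. \<forall>z\<in>I \<times> J. h z = c)"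

text \<open>Taken over the probability measure on the square, where \<open>W\<close> is integrable
  outright; on the plane only its product with an indicator is guaranteed to be.\<close>

definition rect_integral :: "(real \<times> real \<Rightarrow> real) \<Rightarrow> real set \<Rightarrow> real set \<Rightarrow> real" where
  "rect_integral W A B = (LINT z|square_measure. indicator (A \<times> B) z * W z)"

section \<open>The unit square as a probability space\<close>

lemma space_square_measure [simp]: "space square_measure = unit_square"
  by (simp add: space_restrict_space)

lemma unit_square_borel [simp, measurable]: "unit_square \<in> sets borel"
  by (intro borel_Times) auto

lemma Times_in_square_measure [measurable, simp]:
  assumes "A \<in> sets borel" "A \<subseteq> {0..1}" "B \<in> sets borel" "B \<subseteq> {0..1}"
  shows "A \<times> B \<in> sets square_measure"
  using assms by (subst sets_restrict_space_iff) (auto intro!: borel_Times)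

lemma emeasure_unit_interval_finite:
  assumes "A \<subseteq> {0..1::real}"
  shows "emeasure lborel A < \<infinity>"
proof -
  have "emeasure lborel A \<le> emeasure lborel {0..1::real}"
    using assms by (intro emeasure_mono) auto
  then show ?thesis by (simp add: le_less_trans[of _ 1])
qed

lemma fmeasurable_unit_interval:
  assumes "A \<in> sets borel" "A \<subseteq> {0..1::real}"
  shows "A \<in> fmeasurable lborel"
  using assms emeasure_unit_interval_finite by (auto intro: fmeasurableI)

lemma measure_square_Times:
  assumes "A \<in> sets borel" "A \<subseteq> {0..1}" "B \<in> sets borel" "B \<subseteq> {0..1}"
  shows "measure square_measure (A \<times> B) = measure lborel A * measure lborel B"
proof -
  have "measure square_measure (A \<times> B) = measure lborel (A \<times> B)"
    by (rule measure_restrict_space) (use assms in auto)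
  also have "\<dots> = measure (lborel \<Otimes>\<^sub>M lborel) (A \<times> B)"
    by (simp add: lborel_prod)
  also have "\<dots> = measure lborel A * measure lborel B"
    using assms by (simp add: measure_def lborel.emeasure_pair_measure_Times enn2real_mult)
  finally show ?thesis .
qed

lemma prob_space_square_measure: "prob_space square_measure"
proof
  have "emeasure square_measure unit_square = emeasure lborel unit_square"
    by (rule emeasure_restrict_space) auto
  also have "\<dots> = emeasure (lborel \<Otimes>\<^sub>M lborel) ({0..1::real} \<times> {0..1::real})"
    by (simp add: lborel_prod)
  also have "\<dots> = 1"
    by (subst lborel.emeasure_pair_measure_Times) auto
  finally show "emeasure square_measure (space square_measure) = 1" by simp
qed

interpretation square: prob_space square_measure
  by (rule prob_space_square_measure)

lemma integrable_square_bounded: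
  assumes "h \<in> borel_measurable square_measure" "\<And>z. z \<in> unit_square \<Longrightarrow> \<bar>h z\<bar> \<le> B"
  shows "integrable square_measure (h :: _ \<Rightarrow> real)"
  using assms by (intro square.integrable_const_bound[where B = B]) auto

lemma graphon_integrable:
  assumes "graphon W"
  shows "integrable square_measure W"
  using assms unfolding graphon_def set_integrable_def
  by (subst integrable_restrict_space) auto

lemma set_integral_eq_rect_integral:
  assumes "A \<subseteq> {0..1}" "B \<subseteq> {0..1}"
  shows "(LINT z:(A \<times> B)|lborel. W z) = rect_integral W A B"
proof -
  have "rect_integral W A B = (LINT z|lborel. indicator unit_square z *\<^sub>R (indicator (A \<times> B) z * W z))"
    unfolding rect_integral_def by (rule integral_restrict_space) auto
  also have "\<dots> = (LINT z|lborel. indicator (A \<times> B) z *\<^sub>R W z)"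
    using assms by (intro Bochner_Integration.integral_cong) (auto simp: indicator_def)
  finally show ?thesis unfolding set_lebesgue_integral_def by simp
qed

section \<open>Integrals over rectangles: additivity and symmetry\<close>

lemma integrable_rect:
  assumes "integrable square_measure W"
    "A \<in> sets borel" "A \<subseteq> {0..1}" "B \<in> sets borel" "B \<subseteq> {0..1}"
  shows "integrable square_measure (\<lambda>z. indicator (A \<times> B) z * W z :: real)"
  using integrable_mult_indicator[OF Times_in_square_measure[OF assms(2-5)] assms(1)]
  by (simp only: real_scaleR_def)

lemma rect_integral_union_left:
  assumes "integrable square_measure W" "A \<in> sets borel" "A \<subseteq> {0..1}"
    "A' \<in> sets borel" "A' \<subseteq> {0..1}" "B \<in> sets borel" "B \<subseteq> {0..1}" "A \<inter> A' = {}"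
  shows "rect_integral W (A \<union> A') B = rect_integral W A B + rect_integral W A' B"
proof -
  have "indicator ((A \<union> A') \<times> B) z * W z = indicator (A \<times> B) z * W z + indicator (A' \<times> B) z * W z" for z
    using assms(8) by (auto split: split_indicator)
  then show ?thesis
    unfolding rect_integral_def using assms by (simp add: integrable_rect)
qed

lemma rect_integral_union_right:
  assumes "integrable square_measure W" "A \<in> sets borel" "A \<subseteq> {0..1}"
    "B \<in> sets borel" "B \<subseteq> {0..1}" "B' \<in> sets borel" "B' \<subseteq> {0..1}" "B \<inter> B' = {}"
  shows "rect_integral W A (B \<union> B') = rect_integral W A B + rect_integral W A B'"
proof -
  have "indicator (A \<times> (B \<union> B')) z * W z = indicator (A \<times> B) z * W z + indicator (A \<times> B') z * W z" for z
    using assms(8) by (auto split: split_indicator)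
  then show ?thesis
    unfolding rect_integral_def using assms by (simp add: integrable_rect)
qed

text \<open>This is where the symmetry of \<open>W\<close> enters: an estimate for rectangles with a
  thin first side carries over to those with a thin second side.\<close>

lemma rect_integral_swap:
  assumes "graphon W" "A \<in> sets borel" "A \<subseteq> {0..1}" "B \<in> sets borel" "B \<subseteq> {0..1}"
  shows "rect_integral W A B = rect_integral W B A"
proof -
  let ?f = "\<lambda>z. indicator (A \<times> B) z *\<^sub>R W z"
  have W: "set_integrable lborel unit_square W"
    and sym: "\<And>x y. x \<in> {0..1} \<Longrightarrow> y \<in> {0..1} \<Longrightarrow> W (x, y) = W (y, x)"
    using assms(1) unfolding graphon_def by auto
  have "set_integrable lborel (A \<times> B) W"
    by (rule set_integrable_subset[OF W]) (use assms in \<open>auto intro!: borel_Times\<close>)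
  \<comment> \<open>Swapping coordinates needs measurability on the whole plane. \<open>W\<close>
    may lack it, but its product with the indicator of a Borel rectangle inside the square has
    it.\<close>
  then have m: "?f \<in> borel_measurable (lborel \<Otimes>\<^sub>M lborel)"
    unfolding set_integrable_def lborel_prod by auto
  have "rect_integral W A B = integral\<^sup>L (lborel \<Otimes>\<^sub>M lborel) ?f"
    using assms by (subst set_integral_eq_rect_integral[symmetric])
      (auto simp: set_lebesgue_integral_def lborel_prod)
  also have "\<dots> = integral\<^sup>L (lborel \<Otimes>\<^sub>M lborel) (\<lambda>(x, y). ?f (y, x))"
    by (rule lborel_pair.integral_product_swap[OF m, symmetric])
  also have "\<dots> = integral\<^sup>L (lborel \<Otimes>\<^sub>M lborel) (\<lambda>z. indicator (B \<times> A) z *\<^sub>R W z)"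
    using assms sym by (intro Bochner_Integration.integral_cong)
      (auto simp: indicator_def subset_iff)
  also have "\<dots> = rect_integral W B A"
    using assms by (subst set_integral_eq_rect_integral[symmetric])
      (auto simp: set_lebesgue_integral_def lborel_prod)
  finally show ?thesis .
qed

section \<open>Block averages as conditional expectations\<close>

lemma fine_partitionD:
  assumes "fine_partition \<eta> P"
  shows "finite P" "partition_on {0..1} P"
    "J \<in> P \<Longrightarrow> J \<in> sets borel" "J \<in> P \<Longrightarrow> J \<subseteq> {0..1}" "J \<in> P \<Longrightarrow> \<eta> \<le> measure lborel J"
  using assms unfolding fine_partition_def measurable_partition_def partition_on_def by auto

lemma sum_blocks:
  assumes "finite P" "partition_on X P" "I \<in> P" "J \<in> P" "z \<in> I \<times> J"
  shows "(\<Sum>I\<in>P. \<Sum>J\<in>P. indicator (I \<times> J) z * c I J) = (c I J :: real)"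
proof -
  have *: "indicator (I' \<times> J') z * c I' J' = (if J' = J then (if I' = I then c I J else 0) else 0)"
    if "I' \<in> P" "J' \<in> P" for I' J'
    using that assms unfolding partition_on_def disjoint_def
    by (cases z) (auto simp: indicator_def)
  have "(\<Sum>I\<in>P. \<Sum>J\<in>P. indicator (I \<times> J) z * c I J)
      = (\<Sum>I'\<in>P. \<Sum>J'\<in>P. if J' = J then (if I' = I then c I J else 0) else 0)"
    by (intro sum.cong refl *)
  also have "\<dots> = c I J"
    using assms by simp
  finally show ?thesis .
qed

lemma partition_block:
  assumes "partition_on {0..1} P" "z \<in> unit_square"
  obtains I J where "I \<in> P" "J \<in> P" "z \<in> I \<times> J"
  using assms unfolding partition_on_def by (cases z) blast

lemma stepping_eq:
  assumes "fine_partition \<eta> P" "I \<in> P" "J \<in> P" "z \<in> I \<times> J"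
  shows "stepping P W z = 1 / (measure lborel I * measure lborel J) * rect_integral W I J"
  unfolding stepping_def using fine_partitionD[OF assms(1)] assms
  by (subst sum_blocks) (auto simp: set_integral_eq_rect_integral)

lemma blockwise_constant_stepping:
  assumes "fine_partition \<eta> P"
  shows "blockwise_constant P (stepping P W)"
  unfolding blockwise_constant_def using stepping_eq[OF assms] by blast

text \<open>Naming the constant of each block writes \<open>h\<close> as a finite combination of
  block indicators, so that measurability, boundedness and integration reduce to indicators.\<close>

lemma blockwise_constant_sum:
  assumes "fine_partition \<eta> P" "blockwise_constant P h"
  obtains c where "\<And>z. z \<in> unit_square \<Longrightarrow> h z = (\<Sum>I\<in>P. \<Sum>J\<in>P. indicator (I \<times> J) z * c I J)"
proof -
  note P = fine_partitionD[OF assms(1)]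
  obtain c where c: "\<And>I J z. I \<in> P \<Longrightarrow> J \<in> P \<Longrightarrow> z \<in> I \<times> J \<Longrightarrow> h z = c I J"
    using assms(2) unfolding blockwise_constant_def by metis
  show thesis
  proof (rule that)
    fix z assume "z \<in> unit_square"
    then obtain I J where IJ: "I \<in> P" "J \<in> P" "z \<in> I \<times> J"
      using partition_block[OF P(2)] by blast
    then show "h z = (\<Sum>I\<in>P. \<Sum>J\<in>P. indicator (I \<times> J) z * c I J)"
      using sum_blocks[OF P(1,2) IJ] c by simp
  qed
qed

lemma blockwise_constant_measurable:
  assumes "fine_partition \<eta> P" "blockwise_constant P h"
  shows "h \<in> borel_measurable square_measure"
proof -
  note P = fine_partitionD[OF assms(1)]
  obtain c where c: "\<And>z. z \<in> unit_square \<Longrightarrow> h z = (\<Sum>I\<in>P. \<Sum>J\<in>P. indicator (I \<times> J) z * c I J)"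
    using blockwise_constant_sum[OF assms] by blast
  have "(\<lambda>z. \<Sum>I\<in>P. \<Sum>J\<in>P. indicator (I \<times> J) z * c I J) \<in> borel_measurable square_measure"
    using P by (intro borel_measurable_sum borel_measurable_times borel_measurable_indicator
      Times_in_square_measure) auto
  then show ?thesis
    by (subst measurable_cong[where g = "\<lambda>z. \<Sum>I\<in>P. \<Sum>J\<in>P. indicator (I \<times> J) z * c I J"])
       (auto simp: c)
qed

lemma blockwise_constant_bounded:
  assumes "fine_partition \<eta> P" "blockwise_constant P h"
  obtains B where "\<And>z. z \<in> unit_square \<Longrightarrow> \<bar>h z\<bar> \<le> B"
proof -
  obtain c where c: "\<And>z. z \<in> unit_square \<Longrightarrow> h z = (\<Sum>I\<in>P. \<Sum>J\<in>P. indicator (I \<times> J) z * c I J)"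
    using blockwise_constant_sum[OF assms] by blast
  show thesis
  proof (rule that)
    fix z assume "z \<in> unit_square"
    have "\<bar>h z\<bar> \<le> (\<Sum>I\<in>P. \<Sum>J\<in>P. \<bar>indicator (I \<times> J) z * c I J\<bar>)"
      unfolding c[OF \<open>z \<in> unit_square\<close>]
      by (rule order_trans[OF sum_abs]) (intro sum_mono sum_abs)
    also have "\<dots> \<le> (\<Sum>I\<in>P. \<Sum>J\<in>P. \<bar>c I J\<bar>)"
      by (intro sum_mono) (auto simp: indicator_def)
    finally show "\<bar>h z\<bar> \<le> (\<Sum>I\<in>P. \<Sum>J\<in>P. \<bar>c I J\<bar>)" .
  qed
qed

lemma blockwise_constant_integrable:
  assumes "fine_partition \<eta> P" "blockwise_constant P h"
  shows "integrable square_measure h"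
  using blockwise_constant_bounded[OF assms] blockwise_constant_measurable[OF assms]
  by (metis integrable_square_bounded)

lemma integrable_mult_bounded:
  assumes "integrable square_measure W" "h \<in> borel_measurable square_measure"
    "\<And>z. z \<in> unit_square \<Longrightarrow> \<bar>h z\<bar> \<le> (B::real)"
  shows "integrable square_measure (\<lambda>z. W z * h z)"
proof (rule Bochner_Integration.integrable_bound)
  show "integrable square_measure (\<lambda>z. B * W z)" using assms by simp
  show "AE z in square_measure. norm (W z * h z) \<le> norm (B * W z)"
  proof (rule AE_I2)
    fix z assume "z \<in> space square_measure"
    then have "\<bar>h z\<bar> \<le> \<bar>B\<bar>" using assms(3)[of z] by auto
    then show "norm (W z * h z) \<le> norm (B * W z)"
      by (simp add: abs_mult mult.commute[of _ "\<bar>W z\<bar>"] mult_left_mono)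
  qed
qed (use assms in measurable)

lemma integral_mult_blockwise:
  assumes "fine_partition \<eta> P" "integrable square_measure W"
    and c: "\<And>z. z \<in> unit_square \<Longrightarrow> h z = (\<Sum>I\<in>P. \<Sum>J\<in>P. indicator (I \<times> J) z * c I J)"
  shows "(LINT z|square_measure. W z * h z) = (\<Sum>I\<in>P. \<Sum>J\<in>P. c I J * rect_integral W I J)"
proof -
  note P = fine_partitionD[OF assms(1)]
  have "(LINT z|square_measure. W z * h z)
      = (LINT z|square_measure. (\<Sum>I\<in>P. \<Sum>J\<in>P. c I J * (indicator (I \<times> J) z * W z)))"
    by (intro Bochner_Integration.integral_cong)
       (auto simp: c sum_distrib_left mult_ac)
  also have "\<dots> = (\<Sum>I\<in>P. LINT z|square_measure. (\<Sum>J\<in>P. c I J * (indicator (I \<times> J) z * W z)))"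
    using P by (intro Bochner_Integration.integral_sum Bochner_Integration.integrable_sum
      integrable_mult_right integrable_rect assms) auto
  also have "\<dots> = (\<Sum>I\<in>P. \<Sum>J\<in>P. LINT z|square_measure. c I J * (indicator (I \<times> J) z * W z))"
    using P by (intro sum.cong refl Bochner_Integration.integral_sum integrable_mult_right integrable_rect assms) auto
  finally show ?thesis by (simp add: rect_integral_def)
qed

lemma rect_integral_stepping:
  assumes "fine_partition \<eta> P" "\<eta> > 0" "I \<in> P" "J \<in> P"
  shows "rect_integral (stepping P W) I J = rect_integral W I J"
proof -
  note P = fine_partitionD[OF assms(1)]
  let ?c = "1 / (measure lborel I * measure lborel J) * rect_integral W I J"
  \<comment> \<open>Since \<open>\<eta>\<close> is positive no part is a null set, so the value 0
    that division by zero gives to null blocks does not occur.\<close>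
  have pos: "measure lborel I > 0" "measure lborel J > 0"
    using P(5) assms by force+
  have "rect_integral (stepping P W) I J = (LINT z|square_measure. ?c * indicator (I \<times> J) z)"
    unfolding rect_integral_def[of "stepping P W"]
    by (intro Bochner_Integration.integral_cong)
       (auto simp: stepping_eq[OF assms(1,3,4)] split: split_indicator)
  also have "\<dots> = ?c * measure square_measure (I \<times> J)"
    using P assms by (simp add: Int_absorb2 Times_subset_cancel2 Sigma_mono)
  also have "measure square_measure (I \<times> J) = measure lborel I * measure lborel J"
    using P assms by (intro measure_square_Times) auto
  finally show ?thesis using pos by simp
qed

text \<open>The defining property of conditional expectation. Against a blockwise constant function
  an integral depends only on the integrals over blocks, and averaging preserves those.\<close>

lemma integral_stepping_mult:
  assumes "fine_partition \<eta> P" "\<eta> > 0" "integrable square_measure W" "blockwise_constant P h"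
  shows "(LINT z|square_measure. W z * h z) = (LINT z|square_measure. stepping P W z * h z)"
proof -
  obtain c where c: "\<And>z. z \<in> unit_square \<Longrightarrow> h z = (\<Sum>I\<in>P. \<Sum>J\<in>P. indicator (I \<times> J) z * c I J)"
    using blockwise_constant_sum[OF assms(1,4)] by blast
  have s: "integrable square_measure (stepping P W)"
    by (rule blockwise_constant_integrable[OF assms(1) blockwise_constant_stepping[OF assms(1)]])
  show ?thesis
    using integral_mult_blockwise[OF assms(1,3) c] integral_mult_blockwise[OF assms(1) s c]
      rect_integral_stepping[OF assms(1,2)] by simp
qed

text \<open>Intermediate value theorem: the measure of \<open>R \<inter> {0..x}\<close> is
  1-Lipschitz in \<open>x\<close> and runs from 0 to the measure of \<open>R\<close>.\<close>

lemma borel_subset_of_measure: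
  assumes R: "R \<in> sets borel" "R \<subseteq> {0..1::real}" and t: "0 \<le> t" "t \<le> measure lborel R"
  obtains R' where "R' \<in> sets borel" "R' \<subseteq> R" "measure lborel R' = t"
proof -
  define g where "g x = measure lborel (R \<inter> {0..x})" for x
  have fm: "R \<inter> {0..x} \<in> fmeasurable lborel" for x
    using R by (intro fmeasurable_unit_interval) auto
  have lip: "\<bar>g y - g x\<bar> \<le> y - x" if "0 \<le> x" "x \<le> y" for x y
  proof -
    have "g y \<le> measure lborel ((R \<inter> {0..x}) \<union> {x..y})"
      unfolding g_def using R that
      by (intro measure_mono_fmeasurable) (auto intro!: fmeasurable.Un[OF fm] fmeasurableI[of "{x..y}"])
    also have "\<dots> \<le> g x + measure lborel {x..y}"
      unfolding g_def using R by (intro measure_Un_le) auto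
    finally have "g y \<le> g x + (y - x)" using that by simp
    moreover have "g x \<le> g y"
      unfolding g_def using R that by (intro measure_mono_fmeasurable fm) auto
    ultimately show ?thesis by linarith
  qed
  have "continuous_on {0..1} g"
  proof (rule continuous_onI)
    fix x e :: real assume "x \<in> {0..1}" "0 < e"
    then show "\<exists>d>0. \<forall>x'\<in>{0..1}. dist x' x < d \<longrightarrow> dist (g x') (g x) \<le> e"
    proof (intro exI[of _ e] conjI ballI impI)
      fix y assume "y \<in> {0..1}" "dist y x < e"
      then show "dist (g y) (g x) \<le> e"
        using lip[of x y] lip[of y x] \<open>x \<in> {0..1}\<close> by (cases "x \<le> y") (auto simp: dist_real_def)
    qed
  qed
  moreover have "g 0 \<le> t"
  proof -
    have "g 0 \<le> measure lborel {0::real}"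
      unfolding g_def using R by (intro measure_mono_fmeasurable) (auto intro!: fmeasurable_unit_interval)
    then show ?thesis using t by simp
  qed
  moreover have "t \<le> g 1"
    unfolding g_def using t R by (simp add: Int_absorb2)
  ultimately obtain x where "g x = t"
    using IVT'[of g 0 t 1] by auto
  then show thesis
    using R by (intro that[of "R \<inter> {0..x}"]) (auto simp: g_def)
qed

subsection \<open>Truncation of functions with bounded p-norm\<close>

lemma conjugate_exponent_ge_1:
  assumes "p > 1"
  shows "conjugate_exponent p \<ge> 1"
proof (cases "p = \<infinity>")
  case False
  then have "enn2real p > 1"
    using assms by (cases p) (auto simp: ennreal_less_iff simp flip: ennreal_1)
  then show ?thesis using False by (simp add: conjugate_exponent_def)
qed (simp add: conjugate_exponent_def)

lemma Lp_norm_top_bound: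
  assumes "C > 0" "Lp_norm M \<infinity> f \<le> ennreal C" "f \<in> borel_measurable M"
  shows "AE z in M. \<bar>f z\<bar> \<le> C"
proof -
  have "AE z in M. ennreal \<bar>f z\<bar> \<le> esssup M (\<lambda>x. ennreal \<bar>f x\<bar>)"
    by (rule esssup_AE)
  then show ?thesis
  proof eventually_elim
    case (elim z)
    then have "ennreal \<bar>f z\<bar> \<le> ennreal C"
      using assms(2) by (simp add: Lp_norm_def)
    then show ?case using assms(1) by (subst (asm) ennreal_le_iff) auto
  qed
qed

text \<open>Integrability rules out the infinite branch of \<open>Lp_norm\<close>, so the bound
  turns into one on a real integral.\<close>

lemma Lp_norm_finite_bound:
  assumes "C > 0" "p > 1" "p \<noteq> \<infinity>" "Lp_norm M p f \<le> ennreal C"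
    and int: "integrable M (\<lambda>z. \<bar>f z\<bar> powr enn2real p)"
  shows "(LINT z|M. \<bar>f z\<bar> powr enn2real p) \<le> C powr enn2real p"
proof -
  define r where "r = enn2real p"
  define i where "i = (LINT z|M. \<bar>f z\<bar> powr r)"
  have r: "r > 1"
    using assms(2,3) unfolding r_def by (cases p) (auto simp: ennreal_less_iff simp flip: ennreal_1)
  have i: "(\<integral>\<^sup>+ z. ennreal (\<bar>f z\<bar> powr r) \<partial>M) = ennreal i" "i \<ge> 0"
    using int unfolding i_def r_def by (auto intro!: nn_integral_eq_integral)
  then have "ennreal (i powr (1 / r)) \<le> ennreal C"
    using assms(3,4) by (simp add: Lp_norm_def r_def[symmetric] Let_def)
  then have "i powr (1 / r) \<le> C"
    using assms(1) by (subst (asm) ennreal_le_iff) auto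
  then have "(i powr (1 / r)) powr r \<le> C powr r"
    using r by (intro powr_mono2) auto
  then show ?thesis
    using r i by (simp add: powr_powr i_def r_def)
qed

text \<open>Pointwise form of Markov's inequality: the extra factor \<open>(x / K) powr s\<close> is
  at least 1.\<close>

lemma powr_tail_bound:
  assumes "0 < K" "K \<le> x" "0 \<le> s"
  shows "(x::real) powr t \<le> x powr (t + s) * K powr (- s)"
proof -
  have "x powr t * K powr s \<le> x powr t * x powr s"
    using assms by (intro mult_left_mono powr_mono2) auto
  then have "x powr t * K powr s * K powr (- s) \<le> x powr (t + s) * K powr (- s)"
    by (intro mult_right_mono) (auto simp: powr_add)
  moreover have "K powr s * K powr (- s) = 1"
    using assms by (simp add: powr_add[symmetric])
  ultimately show ?thesis by (simp add: mult.assoc)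
qed

text \<open>The height \<open>K\<close> is the one for which Markov's inequality bounds the part of
  \<open>f\<close> above it by exactly \<open>C / a\<close>. The 2-norm of the part below is bounded
  by interpolating between the p-norm and the height \<open>K\<close> if the exponent is less than
  2, and by comparison with the p-norm otherwise.\<close>

lemma Lp_truncation:
  fixes p :: ennreal and C a :: real
  defines "q \<equiv> conjugate_exponent p"
  defines "K \<equiv> C * a powr (q - 1)"
  assumes "C > 0" "p > 1" "a \<ge> 1" "Lp_norm square_measure p f \<le> ennreal C"
    and f: "f \<in> borel_measurable square_measure" "\<And>z. z \<in> unit_square \<Longrightarrow> \<bar>f z\<bar> \<le> B"
  shows "(LINT z|square_measure. (if \<bar>f z\<bar> > K then \<bar>f z\<bar> else 0)) \<le> C / a" (is ?tail)
    and "(LINT z|square_measure. (if \<bar>f z\<bar> > K then 0 else (f z)\<^sup>2)) \<le> 2 * C\<^sup>2 * a powr (max 2 q - 2)"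
      (is ?energy)
proof -
  note [measurable] = f(1)
  have K: "K > 0" using assms by (simp add: K_def)
  have a1: "1 \<le> a powr (max 2 q - 2)"
    using assms by (intro ge_one_powr_ge_zero) auto
  have int_tail: "integrable square_measure (\<lambda>z. if \<bar>f z\<bar> > K then \<bar>f z\<bar> else 0)"
  proof (rule integrable_square_bounded)
    fix z assume "z \<in> unit_square"
    from f(2)[OF this] show "\<bar>if \<bar>f z\<bar> > K then \<bar>f z\<bar> else 0\<bar> \<le> max 0 B" by auto
  qed measurable
  have int_energy: "integrable square_measure (\<lambda>z. if \<bar>f z\<bar> > K then 0 else (f z)\<^sup>2)"
  proof (rule integrable_square_bounded)
    fix z assume "z \<in> unit_square"
    show "\<bar>if \<bar>f z\<bar> > K then 0 else (f z)\<^sup>2\<bar> \<le> K\<^sup>2"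
      using K by (auto simp: abs_le_square_iff[symmetric])
  qed measurable
  have "?tail \<and> ?energy"
  proof (cases "p = \<infinity>")
    case True
    \<comment> \<open>In the limiting case the height is \<open>C\<close> itself, so the part above
      it vanishes almost everywhere.\<close>
    then have q: "q = 1" and KC: "K = C"
      using assms by (auto simp: q_def K_def conjugate_exponent_def)
    have AE: "AE z in square_measure. \<bar>f z\<bar> \<le> C"
      using Lp_norm_top_bound assms True by blast
    have "(LINT z|square_measure. (if \<bar>f z\<bar> > K then \<bar>f z\<bar> else 0)) = 0"
      by (intro integral_eq_zero_AE) (use AE in eventually_elim, auto simp: KC)
    moreover have "(LINT z|square_measure. (if \<bar>f z\<bar> > K then 0 else (f z)\<^sup>2)) \<le> (LINT z|square_measure. C\<^sup>2)"
      by (intro integral_mono_AE int_energy) (auto simp: KC abs_le_square_iff[symmetric])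
    moreover have "C\<^sup>2 \<le> 2 * C\<^sup>2 * a powr (max 2 q - 2)"
    proof -
      have "C\<^sup>2 * 1 \<le> C\<^sup>2 * (2 * a powr (max 2 q - 2))"
        using a1 by (intro mult_left_mono) auto
      then show ?thesis by (simp add: mult_ac)
    qed
    moreover have "(LINT z|square_measure. C\<^sup>2) = C\<^sup>2"
      using square.prob_space by simp
    moreover have "0 \<le> C / a" using \<open>C > 0\<close> \<open>a \<ge> 1\<close> by simp
    ultimately show ?thesis by linarith
  next
    case False
    define r where "r = enn2real p"
    have r: "r > 1"
      using assms(4) False unfolding r_def by (cases p) (auto simp: ennreal_less_iff simp flip: ennreal_1)
    have q: "q = r / (r - 1)"
      using False by (simp add: q_def r_def conjugate_exponent_def)
    \<comment> \<open>The first identity turns \<open>K powr (- (r - 1))\<close> into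
      \<open>C powr (- (r - 1)) / a\<close>; the second turns \<open>K powr (2 - r)\<close> into
      \<open>C powr (2 - r) * a powr (q - 2)\<close>.\<close>
    have q1: "(q - 1) * (r - 1) = 1" and q2: "(q - 1) * (2 - r) = q - 2"
      using r by (auto simp: q field_simps)
    have int_r: "integrable square_measure (\<lambda>z. \<bar>f z\<bar> powr r)"
    proof (rule integrable_square_bounded)
      fix z assume "z \<in> unit_square"
      then show "\<bar>\<bar>f z\<bar> powr r\<bar> \<le> \<bar>B\<bar> powr r"
        using f(2)[of z] r by (auto intro!: powr_mono2)
    qed measurable
    have i: "(LINT z|square_measure. \<bar>f z\<bar> powr r) \<le> C powr r"
      using Lp_norm_finite_bound[of C p square_measure f] assms False int_r by (simp add: r_def)
    have "(LINT z|square_measure. (if \<bar>f z\<bar> > K then \<bar>f z\<bar> else 0))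
        \<le> (LINT z|square_measure. \<bar>f z\<bar> powr r * K powr (- (r - 1)))"
    proof (intro integral_mono int_tail integrable_mult_left int_r)
      fix z
      show "(if \<bar>f z\<bar> > K then \<bar>f z\<bar> else 0) \<le> \<bar>f z\<bar> powr r * K powr (- (r - 1))"
        using powr_tail_bound[of K "\<bar>f z\<bar>" "r - 1" 1] K r by auto
    qed
    also have "\<dots> \<le> C powr r * K powr (- (r - 1))"
      using i by (simp add: mult_right_mono)
    also have "\<dots> = C powr r * (C powr (- (r - 1)) * a powr (- ((q - 1) * (r - 1))))"
      using assms by (simp add: K_def powr_mult powr_powr algebra_simps)
    also have "\<dots> = C powr (r + (- (r - 1))) * a powr (- 1)"
      unfolding q1 powr_add by simp
    also have "\<dots> = C / a"
      using assms by (simp add: powr_minus divide_inverse)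
    finally have tail: ?tail .
    have ?energy
    proof (cases "r < 2")
      case True
      then have "q > 2" using r by (simp add: q field_simps)
      have "(LINT z|square_measure. (if \<bar>f z\<bar> > K then 0 else (f z)\<^sup>2))
          \<le> (LINT z|square_measure. \<bar>f z\<bar> powr r * K powr (2 - r))"
      proof (intro integral_mono int_energy integrable_mult_left int_r)
        fix z
        have "(f z)\<^sup>2 \<le> \<bar>f z\<bar> powr r * K powr (2 - r)" if "\<bar>f z\<bar> \<le> K"
        proof (cases "f z = 0")
          case False
          then have "(f z)\<^sup>2 = \<bar>f z\<bar> powr (r + (2 - r))" by simp
          also have "\<dots> = \<bar>f z\<bar> powr r * \<bar>f z\<bar> powr (2 - r)" by (rule powr_add)
          also have "\<dots> \<le> \<bar>f z\<bar> powr r * K powr (2 - r)"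
            using that True by (intro mult_left_mono powr_mono2) auto
          finally show ?thesis .
        qed simp
        then show "(if \<bar>f z\<bar> > K then 0 else (f z)\<^sup>2) \<le> \<bar>f z\<bar> powr r * K powr (2 - r)"
          by auto
      qed
      also have "\<dots> \<le> C powr r * K powr (2 - r)"
        using i by (simp add: mult_right_mono)
      also have "\<dots> = C powr r * (C powr (2 - r) * a powr ((q - 1) * (2 - r)))"
        using assms by (simp add: K_def powr_mult powr_powr)
      also have "\<dots> = C powr (r + (2 - r)) * a powr (q - 2)"
        unfolding q2 powr_add by simp
      also have "\<dots> = C\<^sup>2 * a powr (max 2 q - 2)"
        using assms \<open>q > 2\<close> by simp
      also have "\<dots> \<le> 2 * (C\<^sup>2 * a powr (max 2 q - 2))"
        using assms by auto
      finally show ?thesis by simp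
    next
      case False
      \<comment> \<open>For \<open>r \<ge> 2\<close> compare at height \<open>C\<close> instead:
        below it the square is at most \<open>C\<^sup>2\<close>, above it Markov applies with
        \<open>r - 2\<close> spare powers. Each case contributes \<open>C\<^sup>2\<close>, which is
        the origin of the factor 2 in the statement.\<close>
      have "(LINT z|square_measure. (if \<bar>f z\<bar> > K then 0 else (f z)\<^sup>2))
          \<le> (LINT z|square_measure. C\<^sup>2 + \<bar>f z\<bar> powr r * C powr (- (r - 2)))"
      proof (intro integral_mono int_energy Bochner_Integration.integrable_add integrable_mult_left int_r)
        fix z
        have "(f z)\<^sup>2 \<le> C\<^sup>2 + \<bar>f z\<bar> powr r * C powr (- (r - 2))"
        proof (cases "\<bar>f z\<bar> \<le> C")
          case True
          then show ?thesis
            using assms by (intro add_increasing2) (auto simp: abs_le_square_iff[symmetric])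
        next
          case le: False
          then show ?thesis
            using powr_tail_bound[of C "\<bar>f z\<bar>" "r - 2" 2] assms False
            by (intro add_increasing) auto
        qed
        then show "(if \<bar>f z\<bar> > K then 0 else (f z)\<^sup>2) \<le> C\<^sup>2 + \<bar>f z\<bar> powr r * C powr (- (r - 2))"
          by (auto intro: order_trans[rotated])
      qed auto
      also have "\<dots> = C\<^sup>2 + (LINT z|square_measure. \<bar>f z\<bar> powr r) * C powr (- (r - 2))"
        using int_r square.prob_space by (subst Bochner_Integration.integral_add) auto
      also have "\<dots> \<le> C\<^sup>2 + C powr r * C powr (- (r - 2))"
        using i by (simp add: mult_right_mono)
      also have "C powr r * C powr (- (r - 2)) = C\<^sup>2"
        using assms by (simp add: powr_add[symmetric])
      also have "C\<^sup>2 + C\<^sup>2 \<le> 2 * C\<^sup>2 * a powr (max 2 q - 2)"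
        using mult_left_mono[OF a1, of "2 * C\<^sup>2"] by simp
      finally show ?thesis .
    qed
    with tail show ?thesis by blast
  qed
  then show ?tail ?energy by blast+
qed

text \<open>Split at the truncation height \<open>K\<close>: on \<open>E\<close> the part up to
  \<open>K\<close> contributes at most \<open>K * a powr (- q) = C / a\<close>, and the part above
  \<open>K\<close> another \<open>C / a\<close>.\<close>

lemma Lp_small_set:
  assumes "C > 0" "p > 1" "a \<ge> 1" "Lp_norm square_measure p f \<le> ennreal C"
    and f: "f \<in> borel_measurable square_measure" "\<And>z. z \<in> unit_square \<Longrightarrow> \<bar>f z\<bar> \<le> B"
    and E: "E \<in> sets square_measure" "measure square_measure E \<le> a powr (- conjugate_exponent p)"
  shows "(LINT z|square_measure. indicator E z * \<bar>f z\<bar>) \<le> 2 * C / a"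
proof -
  note [measurable] = f(1) E(1)
  define q where "q = conjugate_exponent p"
  define K where "K = C * a powr (q - 1)"
  have K: "K > 0" using assms by (simp add: K_def)
  have int_tail: "integrable square_measure (\<lambda>z. if \<bar>f z\<bar> > K then \<bar>f z\<bar> else 0)"
  proof (rule integrable_square_bounded)
    fix z assume "z \<in> unit_square"
    from f(2)[OF this] show "\<bar>if \<bar>f z\<bar> > K then \<bar>f z\<bar> else 0\<bar> \<le> max 0 B" by auto
  qed measurable
  have int_f: "integrable square_measure (\<lambda>z. indicator E z * \<bar>f z\<bar>)"
  proof (rule integrable_square_bounded)
    fix z assume "z \<in> unit_square"
    from f(2)[OF this] show "\<bar>indicator E z * \<bar>f z\<bar>\<bar> \<le> max 0 B"
      by (auto simp: indicator_def)
  qed measurable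
  have int_E: "integrable square_measure (\<lambda>z. K * indicator E z)"
    by (rule integrable_square_bounded[of _ K]) (use K in \<open>auto simp: indicator_def\<close>)
  have "(LINT z|square_measure. indicator E z * \<bar>f z\<bar>)
      \<le> (LINT z|square_measure. K * indicator E z + (if \<bar>f z\<bar> > K then \<bar>f z\<bar> else 0))"
    using K by (intro integral_mono int_f Bochner_Integration.integrable_add int_tail int_E)
      (auto simp: indicator_def)
  also have "\<dots> = K * measure square_measure E
      + (LINT z|square_measure. (if \<bar>f z\<bar> > K then \<bar>f z\<bar> else 0))"
    using sets.sets_into_space[OF E(1)]
    by (subst Bochner_Integration.integral_add[OF int_E int_tail]) (simp add: Int_absorb2)
  also have "\<dots> \<le> K * a powr (- q) + C / a"
    using K E(2) Lp_truncation(1)[OF assms(1-4) f] unfolding q_def K_def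
    by (intro add_mono mult_left_mono) auto
  also have "K * a powr (- q) = C * a powr (q - 1 + - q)"
    unfolding K_def powr_add by simp
  also have "\<dots> = C / a"
    using assms by (simp add: powr_minus divide_inverse)
  finally show ?thesis by simp
qed

subsection \<open>Partitions into parts of measure at least \<open>\<eta>\<close>\<close>

text \<open>Regularity speaks only about sets that are large and have a large complement. A set that
  is too small is a difference of two such sets, and a set with too small a complement is a disjoint
  union of two; additivity then costs a factor 2.\<close>

lemma additive_bound_extend:
  assumes Y: "Y \<in> sets borel" "Y \<subseteq> {0..1::real}" and \<eta>: "0 < \<eta>" "3 * \<eta> \<le> measure lborel Y"
    and add: "\<And>X X'. \<lbrakk>X \<in> sets borel; X \<subseteq> Y; X' \<in> sets borel; X' \<subseteq> Y; X \<inter> X' = {}\<rbrakk>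
      \<Longrightarrow> \<Phi> (X \<union> X') = \<Phi> X + (\<Phi> X' :: real)"
    and bd: "\<And>X. \<lbrakk>X \<in> sets borel; X \<subseteq> Y; \<eta> \<le> measure lborel X; \<eta> \<le> measure lborel (Y - X)\<rbrakk>
      \<Longrightarrow> \<bar>\<Phi> X\<bar> \<le> b"
    and Z: "Z \<in> sets borel" "Z \<subseteq> Y"
  shows "\<bar>\<Phi> Z\<bar> \<le> 2 * b"
proof -
  have sub: "X \<subseteq> {0..1}" if "X \<subseteq> Y" for X using that Y by auto
  have fm: "X \<in> fmeasurable lborel" if "X \<in> sets borel" "X \<subseteq> Y" for X
    using that sub by (intro fmeasurable_unit_interval) auto
  have diff: "measure lborel (X - X') = measure lborel X - measure lborel X'"
    if "X' \<subseteq> X" "X \<subseteq> Y" "X \<in> sets borel" "X' \<in> sets borel" for X X'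
    using that fmeasurableD2[OF fm[of X]] by (intro measure_Diff) auto
  consider (small) "measure lborel Z < \<eta>" | (cosmall) "measure lborel (Y - Z) < \<eta>"
    | (mid) "\<eta> \<le> measure lborel Z" "\<eta> \<le> measure lborel (Y - Z)" by linarith
  then show ?thesis
  proof cases
    case small
    \<comment> \<open>Adjoin a set \<open>R\<close> of measure \<open>\<eta>\<close>. Then
      \<open>Z \<union> R\<close> has measure less than \<open>2 * \<eta>\<close>, and the lower
      bound \<open>3 * \<eta>\<close> for \<open>Y\<close> leaves enough outside it.\<close>
    have "\<eta> \<le> measure lborel (Y - Z)" using small \<eta> diff[of Z Y] Y Z by simp
    then obtain R where R: "R \<in> sets borel" "R \<subseteq> Y - Z" "measure lborel R = \<eta>"
      using borel_subset_of_measure[of "Y - Z" \<eta>] Y Z \<eta> by auto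
    have ZR: "measure lborel (Z \<union> R) = measure lborel Z + \<eta>"
      using R Z fm[of Z] fm[of R]
      by (subst measure_Un2) (auto simp: Diff_triv Un_Diff intro!: arg_cong[where f = "measure lborel"])
    have "\<bar>\<Phi> (Z \<union> R)\<bar> \<le> b"
    proof (intro bd)
      have "Z \<union> R \<subseteq> Y" using R Z by auto
      then show "\<eta> \<le> measure lborel (Y - (Z \<union> R))"
        using diff[of "Z \<union> R" Y] R Z Y ZR small \<eta> by auto
    qed (use R Z ZR in auto)
    moreover have "\<bar>\<Phi> R\<bar> \<le> b"
    proof (intro bd)
      have "R \<subseteq> Y" using R by auto
      then show "\<eta> \<le> measure lborel (Y - R)" using R Y \<eta> diff[of R Y] by auto
    qed (use R in auto)
    moreover have "\<Phi> (Z \<union> R) = \<Phi> Z + \<Phi> R"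
      using R Z by (intro add) auto
    ultimately show ?thesis by linarith
  next
    case cosmall
    \<comment> \<open>Now remove a set \<open>R\<close> of measure \<open>\<eta>\<close> from
      \<open>Z\<close>. What remains still exceeds \<open>\<eta>\<close>, and its complement in
      \<open>Y\<close> contains \<open>R\<close>.\<close>
    have mZ: "measure lborel Z > 2 * \<eta>" using cosmall \<eta> diff[of Z Y] Y Z by simp
    then obtain R where R: "R \<in> sets borel" "R \<subseteq> Z" "measure lborel R = \<eta>"
      using borel_subset_of_measure[of Z \<eta>] Y Z \<eta> by auto
    have RY: "R \<subseteq> Y" using R Z by auto
    have mY: "measure lborel Y \<ge> measure lborel Z"
      using Z Y by (intro measure_mono_fmeasurable fm) auto
    have "\<bar>\<Phi> (Z - R)\<bar> \<le> b"
    proof (intro bd)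
      show "\<eta> \<le> measure lborel (Z - R)" using diff[of R Z] R Z mZ by auto
      have "Z - R \<subseteq> Y" using Z by auto
      then show "\<eta> \<le> measure lborel (Y - (Z - R))"
        using diff[of "Z - R" Y, OF _ order_refl] diff[of R Z] R Z Y mY by auto
    qed (use R Z in auto)
    moreover have "\<bar>\<Phi> R\<bar> \<le> b"
      using R Z RY Y \<eta> mY mZ by (intro bd) (auto simp: diff)
    moreover have "\<Phi> ((Z - R) \<union> R) = \<Phi> (Z - R) + \<Phi> R"
      using R Z by (intro add) auto
    moreover have "(Z - R) \<union> R = Z" using R by auto
    ultimately show ?thesis by simp
  next
    case mid
    then have "\<bar>\<Phi> Z\<bar> \<le> b" using Z by (intro bd)
    then show ?thesis by linarith
  qed
qed

section \<open>Partitions adapted to given sets\<close>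

lemma blockwise_constant_indicator:
  assumes "\<And>J. J \<in> Q \<Longrightarrow> J \<subseteq> X \<or> J \<inter> X = {}" "\<And>J. J \<in> Q \<Longrightarrow> J \<subseteq> Y \<or> J \<inter> Y = {}"
  shows "blockwise_constant Q (indicator (X \<times> Y))"
  unfolding blockwise_constant_def
proof (intro ballI)
  fix I J assume "I \<in> Q" "J \<in> Q"
  with assms[of I] assms(2)[of J] show "\<exists>c::real. \<forall>z\<in>I \<times> J. indicator (X \<times> Y) z = c"
    by (intro exI[of _ "of_bool (I \<subseteq> X \<and> J \<subseteq> Y)"]) (auto simp: indicator_def)
qed

lemma fine_partition_three:
  assumes "X \<in> sets borel" "X' \<in> sets borel" "X \<subseteq> {0..1}" "X' \<subseteq> {0..1}" "X \<inter> X' = {}"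
    "\<eta> > 0" "\<eta> \<le> measure lborel X" "\<eta> \<le> measure lborel X'" "\<eta> \<le> measure lborel ({0..1} - (X \<union> X'))"
  shows "fine_partition \<eta> {X, X', {0..1} - (X \<union> X')}"
proof -
  have "X \<noteq> {}" "X' \<noteq> {}" "{0..1} - (X \<union> X') \<noteq> {}" using assms by force+
  then show ?thesis
    using assms unfolding fine_partition_def measurable_partition_def partition_on_def disjoint_def
    by auto
qed

text \<open>Cutting every part along \<open>S\<close> could create pieces that are too small. The
  decision is made part by part, changing \<open>S\<close> by at most \<open>\<eta>\<close> within
  each part.\<close>

lemma fine_partition_round:
  assumes P: "fine_partition \<eta> P" and \<eta>: "\<eta> > 0" and S: "S \<in> sets borel" "S \<subseteq> {0..1}"
  obtains S' P' where "S' \<in> sets borel" "S' \<subseteq> {0..1}" "fine_partition \<eta> P'"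
    "refines {0..1} P' P" "card P' \<le> 2 * card P" "\<forall>J\<in>P'. J \<subseteq> S' \<or> J \<inter> S' = {}"
    "measure lborel (S - S') \<le> real (card P) * \<eta>" "measure lborel (S' - S) \<le> real (card P) * \<eta>"
proof -
  note PD = fine_partitionD[OF P]
  have cover: "\<Union>P = {0..1}" and disj: "\<And>I J x. I \<in> P \<Longrightarrow> J \<in> P \<Longrightarrow> x \<in> I \<Longrightarrow> x \<in> J \<Longrightarrow> I = J"
    using PD(2) unfolding partition_on_def disjoint_def by blast+
  \<comment> \<open>A part with too little of \<open>S\<close> is left out, a part with too little
    outside \<open>S\<close> is taken whole, any other part is cut. So \<open>\<sigma> J\<close> and
    \<open>J - \<sigma> J\<close> are each empty or of measure at least \<open>\<eta>\<close>; the
    empty ones are discarded in \<open>P'\<close>, since a partition has no empty part.\<close>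
  define \<sigma> where "\<sigma> J = (if measure lborel (J \<inter> S) < \<eta> then {}
    else if measure lborel (J - S) < \<eta> then J else J \<inter> S)" for J
  define S' where "S' = (\<Union>J\<in>P. \<sigma> J)"
  define P' where "P' = (\<Union>J\<in>P. {\<sigma> J, J - \<sigma> J}) - {{}}"
  have \<sigma>_sub: "\<sigma> J \<subseteq> J" for J by (auto simp: \<sigma>_def)
  have \<sigma>_borel: "\<sigma> J \<in> sets borel" if "J \<in> P" for J
    using PD(3)[OF that] S by (auto simp: \<sigma>_def)
  have S'_Int: "J \<inter> S' = \<sigma> J" if "J \<in> P" for J
  proof
    show "\<sigma> J \<subseteq> J \<inter> S'" using that \<sigma>_sub unfolding S'_def by auto
    show "J \<inter> S' \<subseteq> \<sigma> J"
    proof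
      fix x assume "x \<in> J \<inter> S'"
      then obtain I where "I \<in> P" "x \<in> \<sigma> I" "x \<in> J" unfolding S'_def by auto
      then show "x \<in> \<sigma> J" using disj[of I J x] \<sigma>_sub[of I] that by auto
    qed
  qed
  have large: "\<eta> \<le> measure lborel (\<sigma> J)" if "J \<in> P" "\<sigma> J \<noteq> {}" for J
    using that PD(5)[OF that(1)] by (auto simp: \<sigma>_def split: if_splits)
  have large': "\<eta> \<le> measure lborel (J - \<sigma> J)" if "J \<in> P" "J - \<sigma> J \<noteq> {}" for J
    using that PD(5)[OF that(1)] by (auto simp: \<sigma>_def Diff_Int split: if_splits)
  have S'_borel: "S' \<in> sets borel"
    unfolding S'_def using PD(1) \<sigma>_borel by (intro sets.finite_UN) auto
  have S'_sub: "S' \<subseteq> {0..1}" unfolding S'_def using \<sigma>_sub PD(4) by blast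
  have fine: "fine_partition \<eta> P'"
    unfolding fine_partition_def measurable_partition_def
  proof (intro conjI)
    show "finite P'" using PD(1) by (auto simp: P'_def)
    show "\<forall>J\<in>P'. J \<in> sets borel" using PD(3) \<sigma>_borel by (auto simp: P'_def)
    show "\<forall>J\<in>P'. \<eta> \<le> measure lborel J" using large large' by (auto simp: P'_def)
    show "partition_on {0..1} P'"
    proof (rule partition_onI)
      have "\<Union>P' = (\<Union>J\<in>P. \<sigma> J \<union> (J - \<sigma> J))" unfolding P'_def by auto
      also have "\<dots> = \<Union>P" using \<sigma>_sub by auto
      finally have "\<Union>P' = \<Union>P" .
      then show "\<Union>P' = {0..1}" using cover by simp
      show "{} \<notin> P'" by (simp add: P'_def)
      fix p q assume "p \<in> P'" "q \<in> P'" "p \<noteq> q"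
      then show "disjnt p q"
      proof -
        obtain I J where IJ: "I \<in> P" "p = \<sigma> I \<or> p = I - \<sigma> I" "J \<in> P" "q = \<sigma> J \<or> q = J - \<sigma> J"
          using \<open>p \<in> P'\<close> \<open>q \<in> P'\<close> unfolding P'_def by auto
        show ?thesis
        proof (cases "I = J")
          case True
          then show ?thesis using IJ \<open>p \<noteq> q\<close> by (auto simp: disjnt_def)
        next
          case False
          then have "I \<inter> J = {}" using disj IJ by blast
          moreover have "p \<subseteq> I" "q \<subseteq> J" using IJ \<sigma>_sub by auto
          ultimately show ?thesis by (auto simp: disjnt_def)
        qed
      qed
    qed
  qed
  have ref: "refines {0..1} P' P"
    unfolding refines_def
  proof (intro conjI ballI fine_partitionD(2)[OF fine] PD(2))
    fix X assume "X \<in> P'"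
    then obtain J where "J \<in> P" "X = \<sigma> J \<or> X = J - \<sigma> J" by (auto simp: P'_def)
    then show "\<exists>Y\<in>P. X \<subseteq> Y" using \<sigma>_sub by (intro bexI[of _ J]) auto
  qed
  have "card P' \<le> card (\<Union>J\<in>P. {\<sigma> J, J - \<sigma> J})"
    unfolding P'_def using PD(1) by (intro card_mono) auto
  also have "\<dots> \<le> (\<Sum>J\<in>P. card {\<sigma> J, J - \<sigma> J})" using PD(1) by (rule card_UN_le)
  also have "\<dots> \<le> (\<Sum>J\<in>P. 2)" by (intro sum_mono) (simp add: card_insert_if)
  finally have card: "card P' \<le> 2 * card P" by simp
  have const: "\<forall>J\<in>P'. J \<subseteq> S' \<or> J \<inter> S' = {}"
  proof
    fix J assume "J \<in> P'"
    then obtain I where I: "I \<in> P" "J = \<sigma> I \<or> J = I - \<sigma> I" unfolding P'_def by blast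
    then show "J \<subseteq> S' \<or> J \<inter> S' = {}" using S'_Int[OF I(1)] by auto
  qed
  have sum_bound: "measure lborel (\<Union>J\<in>P. D J) \<le> real (card P) * \<eta>"
    if "\<And>J. J \<in> P \<Longrightarrow> D J \<in> sets borel" "\<And>J. J \<in> P \<Longrightarrow> measure lborel (D J) \<le> \<eta>" for D
  proof -
    have "measure lborel (\<Union>J\<in>P. D J) \<le> (\<Sum>J\<in>P. measure lborel (D J))"
      using that PD(1) by (intro measure_UNION_le) auto
    also have "\<dots> \<le> (\<Sum>J\<in>P. \<eta>)" using that by (intro sum_mono)
    finally show ?thesis by simp
  qed
  have eq1: "S - S' = (\<Union>J\<in>P. (J \<inter> S) - \<sigma> J)"
  proof -
    have "S - S' = (\<Union>J\<in>P. (J \<inter> S) - (J \<inter> S'))" using S cover by auto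
    then show ?thesis using S'_Int by simp
  qed
  have eq2: "S' - S = (\<Union>J\<in>P. \<sigma> J - S)"
    unfolding S'_def by blast
  have le1: "measure lborel (S - S') \<le> real (card P) * \<eta>"
    unfolding eq1
  proof (rule sum_bound)
    fix J assume J: "J \<in> P"
    show "J \<inter> S - \<sigma> J \<in> sets borel" using \<sigma>_borel[OF J] PD(3)[OF J] S by auto
    have e: "J \<inter> S - J = {}" "J \<inter> S - S = {}" by auto
    show "measure lborel (J \<inter> S - \<sigma> J) \<le> \<eta>" using \<eta> by (simp add: \<sigma>_def e)
  qed
  have le2: "measure lborel (S' - S) \<le> real (card P) * \<eta>"
    unfolding eq2
  proof (rule sum_bound)
    fix J assume J: "J \<in> P"
    show "\<sigma> J - S \<in> sets borel" using \<sigma>_borel[OF J] S by auto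
    have e: "J \<inter> S - S = {}" by auto
    show "measure lborel (\<sigma> J - S) \<le> \<eta>" using \<eta> by (simp add: \<sigma>_def e)
  qed
  show thesis
    by (rule that[OF S'_borel S'_sub fine ref card const le1 le2])
qed

section \<open>Refinement, averages of indicators and orthogonal sums\<close>

lemma blockwise_constant_refine:
  assumes "refines X P' P" "blockwise_constant P h"
  shows "blockwise_constant P' h"
  unfolding blockwise_constant_def
proof (intro ballI)
  fix I J assume "I \<in> P'" "J \<in> P'"
  then obtain I' J' where "I' \<in> P" "I \<subseteq> I'" "J' \<in> P" "J \<subseteq> J'"
    using assms(1) unfolding refines_def by meson
  then have "I \<times> J \<subseteq> I' \<times> J'" "\<exists>c. \<forall>z\<in>I' \<times> J'. h z = c"
    using assms(2) unfolding blockwise_constant_def by blast+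
  then show "\<exists>c. \<forall>z\<in>I \<times> J. h z = c" by blast
qed

lemma blockwise_constant_map2:
  assumes "blockwise_constant P f" "blockwise_constant P g"
  shows "blockwise_constant P (\<lambda>z. F (f z) (g z))"
  unfolding blockwise_constant_def
proof (intro ballI)
  fix I J assume "I \<in> P" "J \<in> P"
  then obtain c d where "\<forall>z\<in>I \<times> J. f z = c" "\<forall>z\<in>I \<times> J. g z = d"
    using assms unfolding blockwise_constant_def by meson
  then show "\<exists>c. \<forall>z\<in>I \<times> J. F (f z) (g z) = c" by (intro exI[of _ "F c d"]) simp
qed

lemma measure_unit_interval_le_1:
  assumes "A \<in> sets borel" "A \<subseteq> {0..1::real}"
  shows "measure lborel A \<le> 1"
  using measure_mono_fmeasurable[OF assms(2) _ fmeasurable_unit_interval[of "{0..1}"]] assms by simp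

lemma measure_unit_interval_compl:
  assumes "A \<in> sets borel" "A \<subseteq> {0..1::real}"
  shows "measure lborel ({0..1} - A) = 1 - measure lborel A"
  using assms by (subst measure_Diff) auto

text \<open>On a block \<open>I \<times> J\<close> the average is the proportion of the block that
  lies in \<open>S \<times> T\<close>.\<close>

lemma stepping_indicator_bounds:
  assumes P: "fine_partition \<eta> P" and "\<eta> > 0"
    and S: "S \<in> sets borel" "S \<subseteq> {0..1}" and T: "T \<in> sets borel" "T \<subseteq> {0..1}"
    and z: "z \<in> unit_square"
  shows "0 \<le> stepping P (indicator (S \<times> T)) z" "stepping P (indicator (S \<times> T)) z \<le> 1"
proof -
  note PD = fine_partitionD[OF P]
  obtain I J where IJ: "I \<in> P" "J \<in> P" "z \<in> I \<times> J"
    using partition_block[OF PD(2) z] .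
  have pos: "measure lborel I * measure lborel J > 0"
    using PD(5)[OF IJ(1)] PD(5)[OF IJ(2)] \<open>\<eta> > 0\<close> by simp
  have "indicator (I \<times> J) w * indicator (S \<times> T) w = (indicator ((I \<inter> S) \<times> (J \<inter> T)) w :: real)" for w
    by (auto simp: indicator_def)
  then have "rect_integral (indicator (S \<times> T)) I J = measure square_measure ((I \<inter> S) \<times> (J \<inter> T))"
    using PD(4)[OF IJ(1)] PD(4)[OF IJ(2)] by (simp add: rect_integral_def)
      (intro arg_cong[where f = "measure square_measure"], auto)
  also have "\<dots> = measure lborel (I \<inter> S) * measure lborel (J \<inter> T)"
    using PD(3,4) IJ S T by (intro measure_square_Times) auto
  finally have eq: "rect_integral (indicator (S \<times> T)) I J = measure lborel (I \<inter> S) * measure lborel (J \<inter> T)" .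
  have "measure lborel (I \<inter> S) * measure lborel (J \<inter> T) \<le> measure lborel I * measure lborel J"
    using PD(3,4) IJ S T
    by (intro mult_mono measure_mono_fmeasurable fmeasurable_unit_interval) auto
  then show "0 \<le> stepping P (indicator (S \<times> T)) z" "stepping P (indicator (S \<times> T)) z \<le> 1"
    using pos unfolding stepping_eq[OF P IJ] eq by (auto simp: field_simps)
qed

lemma integral_sum_square_orthogonal:
  fixes n :: nat
  assumes int: "\<And>i j. i < n \<Longrightarrow> j < n \<Longrightarrow> integrable M (\<lambda>z. g i z * g j z :: real)"
    and orth: "\<And>i j. i < j \<Longrightarrow> j < n \<Longrightarrow> (LINT z|M. g i z * g j z) = 0"
  shows "(LINT z|M. (\<Sum>i<n. g i z)\<^sup>2) = (\<Sum>i<n. LINT z|M. (g i z)\<^sup>2)"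
proof -
  have off: "(LINT z|M. g i z * g j z) = 0" if "i \<noteq> j" "i < n" "j < n" for i j
    using orth[of i j] orth[of j i] that by (cases i j rule: linorder_cases) (auto simp: mult.commute)
  have "(LINT z|M. (\<Sum>i<n. g i z)\<^sup>2) = (LINT z|M. (\<Sum>i<n. (\<Sum>j<n. g i z * g j z)))"
    by (simp add: power2_eq_square sum_product)
  also have "\<dots> = (\<Sum>i<n. LINT z|M. (\<Sum>j<n. g i z * g j z))"
    using int by (intro Bochner_Integration.integral_sum Bochner_Integration.integrable_sum) auto
  also have "\<dots> = (\<Sum>i<n. \<Sum>j<n. LINT z|M. g i z * g j z)"
    using int by (intro sum.cong refl Bochner_Integration.integral_sum) auto
  also have "\<dots> = (\<Sum>i<n. \<Sum>j<n. if j = i then (LINT z|M. (g i z)\<^sup>2) else 0)"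
    using off by (intro sum.cong refl) (auto simp: power2_eq_square)
  finally show ?thesis by simp
qed

subsection \<open>Upper regular graphons\<close>

text \<open>Here \<open>\<eta>\<close> is any positive number; how small it must be is stated as a
  hypothesis wherever thin sets are estimated.\<close>

locale upper_regular_graphon =
  fixes C \<eta> :: real and p :: ennreal and W :: "real \<times> real \<Rightarrow> real"
  assumes C_pos: "C > 0" and p_gt_1: "p > 1" and \<eta>_pos: "\<eta> > 0"
    and graphon: "graphon W" and regular: "upper_Lp_regular C \<eta> p W"
begin

lemma W_integrable: "integrable square_measure W"
  by (rule graphon_integrable[OF graphon])

lemma Lp_norm_stepping:
  assumes "fine_partition \<eta> P"
  shows "Lp_norm square_measure p (stepping P W) \<le> ennreal C"
  using regular assms unfolding upper_Lp_regular_def fine_partition_def by blast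

section \<open>Integrals over thin rectangles\<close>

lemma stepping_small_set:
  assumes P: "fine_partition \<eta> P" and "a \<ge> 1" "E \<in> sets square_measure"
    "measure square_measure E \<le> a powr (- conjugate_exponent p)"
  shows "(LINT z|square_measure. indicator E z * \<bar>stepping P W z\<bar>) \<le> 2 * C / a"
proof -
  note s = blockwise_constant_stepping[OF P, of W]
  obtain B where "\<And>z. z \<in> unit_square \<Longrightarrow> \<bar>stepping P W z\<bar> \<le> B"
    using blockwise_constant_bounded[OF P s] by blast
  then show ?thesis
    using Lp_small_set[OF C_pos p_gt_1 assms(2) Lp_norm_stepping[OF P]
      blockwise_constant_measurable[OF P s] _ assms(3,4)] by blast
qed

lemma integrable_stepping:
  assumes "fine_partition \<eta> P"
  shows "integrable square_measure (stepping P V)"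
  by (rule blockwise_constant_integrable[OF assms blockwise_constant_stepping[OF assms]])

lemma stepping_rect_bound:
  assumes P: "fine_partition \<eta> P" and "a \<ge> 1"
    and A: "A \<in> sets borel" "A \<subseteq> {0..1}" and B: "B \<in> sets borel" "B \<subseteq> {0..1}"
    and small: "measure lborel A * measure lborel B \<le> a powr (- conjugate_exponent p)"
  shows "\<bar>rect_integral (stepping P W) A B\<bar> \<le> 2 * C / a"
proof -
  have "\<bar>rect_integral (stepping P W) A B\<bar>
      \<le> (LINT z|square_measure. \<bar>indicator (A \<times> B) z * stepping P W z\<bar>)"
    unfolding rect_integral_def by (rule integral_abs_bound)
  also have "\<dots> = (LINT z|square_measure. indicator (A \<times> B) z * \<bar>stepping P W z\<bar>)"
    by (simp add: abs_mult)
  also have "\<dots> \<le> 2 * C / a"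
    using A B small by (intro stepping_small_set P assms) (auto simp: measure_square_Times)
  finally show ?thesis .
qed

text \<open>On a union of blocks of \<open>Q\<close> the integrals of \<open>W\<close> and of its
  average agree, and the average has bounded p-norm. The partition \<open>Q\<close> is auxiliary and
  may be tailored to the rectangle.\<close>

lemma block_rect_bound:
  assumes Q: "fine_partition \<eta> Q" and "a \<ge> 1"
    and A: "A \<in> sets borel" "A \<subseteq> {0..1}" and B: "B \<in> sets borel" "B \<subseteq> {0..1}"
    and small: "measure lborel A * measure lborel B \<le> a powr (- conjugate_exponent p)"
    and const: "\<And>J. J \<in> Q \<Longrightarrow> J \<subseteq> A \<or> J \<inter> A = {}" "\<And>J. J \<in> Q \<Longrightarrow> J \<subseteq> B \<or> J \<inter> B = {}"
  shows "\<bar>rect_integral W A B\<bar> \<le> 2 * C / a"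
proof -
  have "rect_integral W A B = rect_integral (stepping Q W) A B"
    using integral_stepping_mult[OF Q \<eta>_pos W_integrable blockwise_constant_indicator[OF const]]
    by (simp add: rect_integral_def mult.commute)
  then show ?thesis using stepping_rect_bound[OF assms(1-7)] by simp
qed

text \<open>
  Splitting \<open>B\<close> along \<open>A\<close> avoids partitions generated by two overlapping sets, whose atoms could be
  smaller than \<open>\<eta>\<close>.
\<close>
lemma medium_rect_bound:
  assumes a: "a \<ge> 1" and A: "A \<in> sets borel" "A \<subseteq> {0..1}" and B: "B \<in> sets borel" "B \<subseteq> {0..1}"
    and mA: "3 * \<eta> \<le> measure lborel A" "measure lborel A \<le> a powr (- conjugate_exponent p)"
      "measure lborel A + 3 * \<eta> \<le> 1"
  shows "\<bar>rect_integral W A B\<bar> \<le> 8 * C / a"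
proof -
  have add: "rect_integral W A (X \<union> X') = rect_integral W A X + rect_integral W A X'"
    if "X \<in> sets borel" "X \<subseteq> Y" "X' \<in> sets borel" "X' \<subseteq> Y" "X \<inter> X' = {}" "Y \<subseteq> {0..1}" for X X' Y
    using that A by (intro rect_integral_union_right W_integrable) auto
  have small: "measure lborel A * measure lborel X \<le> a powr (- conjugate_exponent p)"
    if "X \<in> sets borel" "X \<subseteq> {0..1}" for X :: "real set"
    using mult_left_mono[OF measure_unit_interval_le_1[OF that], of "measure lborel A"] mA by simp
  have compl: "measure lborel ({0..1} - A) = 1 - measure lborel A"
    using A by (rule measure_unit_interval_compl)
  \<comment> \<open>With \<open>A\<close> fixed, the integral is additive in the second side. It is
    bounded on admissible subsets of \<open>A\<close>, and likewise of its complement, and then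
    extended to all Borel subsets; the lower bounds \<open>3 * \<eta>\<close> for \<open>A\<close>
    and for its complement serve this. The two halves add up to \<open>8 * C / a\<close>.\<close>
  have inside: "\<bar>rect_integral W A (B \<inter> A)\<bar> \<le> 2 * (2 * C / a)"
  proof (rule additive_bound_extend[OF A \<eta>_pos mA(1)])
    show "rect_integral W A (X \<union> X') = rect_integral W A X + rect_integral W A X'"
      if "X \<in> sets borel" "X \<subseteq> A" "X' \<in> sets borel" "X' \<subseteq> A" "X \<inter> X' = {}" for X X'
      using add that A by blast
    show "\<bar>rect_integral W A X\<bar> \<le> 2 * C / a"
      if X: "X \<in> sets borel" "X \<subseteq> A" "\<eta> \<le> measure lborel X" "\<eta> \<le> measure lborel (A - X)" for X
    proof (rule block_rect_bound[OF _ a A])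
      have "X \<union> (A - X) = A" using X by auto
      then show "fine_partition \<eta> {X, A - X, {0..1} - (X \<union> (A - X))}"
        using X A mA compl \<eta>_pos by (intro fine_partition_three) auto
    qed (use X A small in auto)
  qed (use A B in auto)
  have outside: "\<bar>rect_integral W A (B - A)\<bar> \<le> 2 * (2 * C / a)"
  proof (rule additive_bound_extend[of "{0..1} - A", OF _ _ \<eta>_pos])
    show "rect_integral W A (X \<union> X') = rect_integral W A X + rect_integral W A X'"
      if "X \<in> sets borel" "X \<subseteq> {0..1} - A" "X' \<in> sets borel" "X' \<subseteq> {0..1} - A" "X \<inter> X' = {}" for X X'
      using that by (intro add[of _ "{0..1} - A"]) auto
    show "\<bar>rect_integral W A X\<bar> \<le> 2 * C / a"
      if X: "X \<in> sets borel" "X \<subseteq> {0..1} - A" "\<eta> \<le> measure lborel X"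
        "\<eta> \<le> measure lborel ({0..1} - A - X)" for X
    proof (rule block_rect_bound[OF _ a A])
      show "fine_partition \<eta> {A, X, {0..1} - (A \<union> X)}"
        using X A mA \<eta>_pos by (intro fine_partition_three) (auto simp: Diff_Un Diff_Diff_Int set_diff_eq)
    qed (use X A small in auto)
  qed (use A B mA compl in auto)
  have "rect_integral W A ((B \<inter> A) \<union> (B - A)) = rect_integral W A (B \<inter> A) + rect_integral W A (B - A)"
    using A B by (intro add[of _ "{0..1}"]) auto
  moreover have "(B \<inter> A) \<union> (B - A) = B" by auto
  ultimately show ?thesis using inside outside by simp
qed

text \<open>Even a null set \<open>A\<close> is covered: enlarge it by a disjoint \<open>R\<close>
  of measure \<open>3 * \<eta>\<close>. Both \<open>A \<union> R\<close> and \<open>R\<close> fall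
  under \<open>medium_rect_bound\<close>, and subtracting doubles the constant. The slack
  \<open>6 * \<eta>\<close> is \<open>3 * \<eta>\<close> for \<open>R\<close> and
  \<open>3 * \<eta>\<close> for the complement required there.\<close>

lemma small_rect_bound:
  assumes a: "a \<ge> 1" and A: "A \<in> sets borel" "A \<subseteq> {0..1}" and B: "B \<in> sets borel" "B \<subseteq> {0..1}"
    and mA: "measure lborel A + 3 * \<eta> \<le> a powr (- conjugate_exponent p)"
      "measure lborel A + 6 * \<eta> \<le> 1"
  shows "\<bar>rect_integral W A B\<bar> \<le> 16 * C / a"
proof -
  have "3 * \<eta> \<le> measure lborel ({0..1} - A)"
    using measure_unit_interval_compl[OF A] mA \<eta>_pos by simp
  then obtain R where R: "R \<in> sets borel" "R \<subseteq> {0..1} - A" "measure lborel R = 3 * \<eta>"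
    using borel_subset_of_measure[of "{0..1} - A" "3 * \<eta>"] A \<eta>_pos by auto
  have m: "measure lborel (A \<union> R) = measure lborel A + 3 * \<eta>"
  proof -
    have "R - A = R" "R \<subseteq> {0..1}" using R by auto
    then show ?thesis
      using R A fmeasurable_unit_interval[of A] fmeasurable_unit_interval[of R]
      by (subst measure_Un2) auto
  qed
  have "3 * \<eta> \<le> a powr (- conjugate_exponent p)" "6 * \<eta> \<le> 1"
    using mA measure_nonneg[of lborel A] by linarith+
  then have "\<bar>rect_integral W (A \<union> R) B\<bar> \<le> 8 * C / a" "\<bar>rect_integral W R B\<bar> \<le> 8 * C / a"
    using R A B mA m \<eta>_pos by (auto intro!: medium_rect_bound a)
  moreover have "rect_integral W (A \<union> R) B = rect_integral W A B + rect_integral W R B"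
    using R A B by (intro rect_integral_union_left W_integrable) auto
  ultimately show ?thesis by simp
qed

section \<open>Deviation from the block average and rounding of rectangles\<close>

definition deviation :: "real set set \<Rightarrow> real set \<Rightarrow> real set \<Rightarrow> real" where
  "deviation P A B = rect_integral (\<lambda>z. W z - stepping P W z) A B"

lemma deviation_eq:
  assumes "fine_partition \<eta> P" "A \<in> sets borel" "A \<subseteq> {0..1}" "B \<in> sets borel" "B \<subseteq> {0..1}"
  shows "deviation P A B = rect_integral W A B - rect_integral (stepping P W) A B"
  unfolding deviation_def rect_integral_def
  using integrable_rect[OF W_integrable assms(2-5)] integrable_rect[OF integrable_stepping[OF assms(1)] assms(2-5)]
  by (simp add: right_diff_distrib)

text \<open>The constant is 16 from \<open>W\<close> plus 2 from its average. For a thin second side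
  the term in \<open>W\<close> is handled by symmetry, the term in the average directly, because its
  bound depends only on the area of the rectangle.\<close>

lemma deviation_small:
  assumes P: "fine_partition \<eta> P" and a: "a \<ge> 1"
    and A: "A \<in> sets borel" "A \<subseteq> {0..1}" and B: "B \<in> sets borel" "B \<subseteq> {0..1}"
    and mA: "measure lborel A + 3 * \<eta> \<le> a powr (- conjugate_exponent p)"
      "measure lborel A + 6 * \<eta> \<le> 1"
  shows "\<bar>deviation P A B\<bar> \<le> 18 * C / a" "\<bar>deviation P B A\<bar> \<le> 18 * C / a"
proof -
  have "measure lborel A * measure lborel B \<le> measure lborel A"
    using mult_left_mono[OF measure_unit_interval_le_1[OF B], of "measure lborel A"] by simp
  then have m: "measure lborel A * measure lborel B \<le> a powr (- conjugate_exponent p)"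
    using mA \<eta>_pos by linarith
  have "\<bar>rect_integral W A B\<bar> \<le> 16 * C / a"
    by (rule small_rect_bound[OF a A B mA])
  moreover have "\<bar>rect_integral (stepping P W) A B\<bar> \<le> 2 * C / a"
    by (rule stepping_rect_bound[OF P a A B m])
  moreover have "\<bar>rect_integral (stepping P W) B A\<bar> \<le> 2 * C / a"
    by (rule stepping_rect_bound[OF P a B A]) (use m in \<open>simp add: mult.commute\<close>)
  moreover have "rect_integral W B A = rect_integral W A B"
    by (rule rect_integral_swap[OF graphon B A])
  moreover have "18 * C / a = 16 * C / a + 2 * C / a" by (simp add: add_divide_distrib[symmetric])
  ultimately show "\<bar>deviation P A B\<bar> \<le> 18 * C / a" "\<bar>deviation P B A\<bar> \<le> 18 * C / a"
    using deviation_eq[OF P A B] deviation_eq[OF P B A] by linarith+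
qed

text \<open>Round \<open>S\<close> to \<open>P\<close> and then \<open>T\<close> to the resulting
  partition, each time at most doubling the number of parts. Passing from
  \<open>S \<times> T\<close> through \<open>S' \<times> T\<close> to \<open>S' \<times> T'\<close>
  adds or removes four thin strips, each with deviation at most \<open>18 * C / a\<close>. The
  deviation is measured against the old partition \<open>P\<close> throughout.\<close>

lemma refine_step:
  assumes P: "fine_partition \<eta> P" and a: "a \<ge> 1"
    and S: "S \<in> sets borel" "S \<subseteq> {0..1}" and T: "T \<in> sets borel" "T \<subseteq> {0..1}"
    and m: "2 * real (card P) * \<eta> + 3 * \<eta> \<le> a powr (- conjugate_exponent p)"
      "2 * real (card P) * \<eta> + 6 * \<eta> \<le> 1"
  obtains P' S' T' where "fine_partition \<eta> P'" "refines {0..1} P' P" "card P' \<le> 4 * card P"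
    "S' \<in> sets borel" "S' \<subseteq> {0..1}" "T' \<in> sets borel" "T' \<subseteq> {0..1}"
    "\<forall>J\<in>P'. J \<subseteq> S' \<or> J \<inter> S' = {}" "\<forall>J\<in>P'. J \<subseteq> T' \<or> J \<inter> T' = {}"
    "\<bar>deviation P S T - deviation P S' T'\<bar> \<le> 72 * C / a"
proof -
  obtain S' P1 where S': "S' \<in> sets borel" "S' \<subseteq> {0..1}"
    and P1: "fine_partition \<eta> P1" "refines {0..1} P1 P" "card P1 \<le> 2 * card P"
      "\<forall>J\<in>P1. J \<subseteq> S' \<or> J \<inter> S' = {}"
    and mS: "measure lborel (S - S') \<le> card P * \<eta>" "measure lborel (S' - S) \<le> card P * \<eta>"
    using fine_partition_round[OF P \<eta>_pos S] .
  obtain T' P2 where T': "T' \<in> sets borel" "T' \<subseteq> {0..1}"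
    and P2: "fine_partition \<eta> P2" "refines {0..1} P2 P1" "card P2 \<le> 2 * card P1"
      "\<forall>J\<in>P2. J \<subseteq> T' \<or> J \<inter> T' = {}"
    and mT: "measure lborel (T - T') \<le> card P1 * \<eta>" "measure lborel (T' - T) \<le> card P1 * \<eta>"
    using fine_partition_round[OF P1(1) \<eta>_pos T] .
  have c: "real (card P1) * \<eta> \<le> 2 * real (card P) * \<eta>"
    using P1(3) \<eta>_pos by (intro mult_right_mono) linarith+
  have c': "real (card P) * \<eta> \<le> 2 * real (card P) * \<eta>"
    using \<eta>_pos by (intro mult_right_mono) linarith+
  have const: "\<forall>J\<in>P2. J \<subseteq> S' \<or> J \<inter> S' = {}"
  proof
    fix J assume "J \<in> P2"
    then obtain I where "I \<in> P1" "J \<subseteq> I" using P2(2) unfolding refines_def by meson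
    moreover have "I \<subseteq> S' \<or> I \<inter> S' = {}" using P1(4) \<open>I \<in> P1\<close> by (rule bspec)
    ultimately show "J \<subseteq> S' \<or> J \<inter> S' = {}" by auto
  qed
  have V: "integrable square_measure (\<lambda>z. W z - stepping P W z)"
    using W_integrable integrable_stepping[OF P] by simp
  have split_left: "deviation P A B = deviation P (A \<inter> A') B + deviation P (A - A') B"
    if "A \<in> sets borel" "A \<subseteq> {0..1}" "A' \<in> sets borel" "B \<in> sets borel" "B \<subseteq> {0..1}" for A A' B
  proof -
    have "deviation P ((A \<inter> A') \<union> (A - A')) B = deviation P (A \<inter> A') B + deviation P (A - A') B"
      unfolding deviation_def using that by (intro rect_integral_union_left V) auto
    moreover have "(A \<inter> A') \<union> (A - A') = A" by auto
    ultimately show ?thesis by simp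
  qed
  have split_right: "deviation P A B = deviation P A (B \<inter> B') + deviation P A (B - B')"
    if "A \<in> sets borel" "A \<subseteq> {0..1}" "B' \<in> sets borel" "B \<in> sets borel" "B \<subseteq> {0..1}" for A B B'
  proof -
    have "deviation P A ((B \<inter> B') \<union> (B - B')) = deviation P A (B \<inter> B') + deviation P A (B - B')"
      unfolding deviation_def using that by (intro rect_integral_union_right V) auto
    moreover have "(B \<inter> B') \<union> (B - B') = B" by auto
    ultimately show ?thesis by simp
  qed
  \<comment> \<open>The second rounding starts from up to \<open>2 * card P\<close> parts; the
    factor 2 in the hypotheses \<open>m\<close> pays for this.\<close>
  have thin: "x + 3 * \<eta> \<le> a powr (- conjugate_exponent p) \<and> x + 6 * \<eta> \<le> 1"
    if "x \<le> real (card P) * \<eta> \<or> x \<le> real (card P1) * \<eta>" for x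
    using that c c' m by linarith
  have "\<bar>deviation P (S - S') T\<bar> \<le> 18 * C / a" "\<bar>deviation P (S' - S) T\<bar> \<le> 18 * C / a"
    using S S' T thin mS by (auto intro!: deviation_small(1) P a)
  moreover have "\<bar>deviation P S' (T - T')\<bar> \<le> 18 * C / a" "\<bar>deviation P S' (T' - T)\<bar> \<le> 18 * C / a"
    using S S' T T' thin mT by (auto intro!: deviation_small(2) P a)
  moreover have "deviation P S T = deviation P (S \<inter> S') T + deviation P (S - S') T"
    "deviation P S' T = deviation P (S' \<inter> S) T + deviation P (S' - S) T"
    using S S' T by (auto intro!: split_left)
  moreover have "deviation P S' T = deviation P S' (T \<inter> T') + deviation P S' (T - T')"
    "deviation P S' T' = deviation P S' (T' \<inter> T) + deviation P S' (T' - T)"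
    using S' T T' by (auto intro!: split_right)
  moreover have "72 * C / a = 4 * (18 * C / a)" by simp
  ultimately have "\<bar>deviation P S T - deviation P S' T'\<bar> \<le> 72 * C / a"
    unfolding Int_commute[of S' S] Int_commute[of T' T] by linarith
  moreover have "card P2 \<le> 4 * card P" using P1(3) P2(3) by linarith
  ultimately show thesis
    by (intro that[OF P2(1) refines_trans[OF P2(2) P1(2)] _ S' T' const P2(4)])
qed

text \<open>
  Pair the average \<open>f\<close> of \<open>W\<close> over the last partition with the sum \<open>G\<close> of the martingale differences
  \<open>g i\<close>. Where \<open>f\<close> is large use \<open>f G \<le> n \<bar>f\<bar>\<close>, elsewhere \<open>f G \<le> f\<^sup>2 / (2 t) + t G\<^sup>2 / 2\<close> with
  \<open>t = \<theta> - C / a\<close>.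
\<close>
lemma refinement_chain_length:
  fixes Q :: "nat \<Rightarrow> real set set"
  assumes Q: "\<And>i. i \<le> n \<Longrightarrow> fine_partition \<eta> (Q i)"
    and ref: "\<And>i. i < n \<Longrightarrow> refines {0..1} (Q (Suc i)) (Q i)"
    and S: "\<And>i. i < n \<Longrightarrow> S i \<in> sets borel \<and> S i \<subseteq> {0..1}"
    and T: "\<And>i. i < n \<Longrightarrow> T i \<in> sets borel \<and> T i \<subseteq> {0..1}"
    and const: "\<And>i J. i < n \<Longrightarrow> J \<in> Q (Suc i) \<Longrightarrow> J \<subseteq> S i \<or> J \<inter> S i = {}"
      "\<And>i J. i < n \<Longrightarrow> J \<in> Q (Suc i) \<Longrightarrow> J \<subseteq> T i \<or> J \<inter> T i = {}"
    and dev: "\<And>i. i < n \<Longrightarrow> \<theta> \<le> \<bar>deviation (Q i) (S i) (T i)\<bar>"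
    and a: "a \<ge> 1" and \<theta>: "C / a < \<theta>"
  shows "real n * (\<theta> - C / a)\<^sup>2 \<le> 2 * C\<^sup>2 * a powr (max 2 (conjugate_exponent p) - 2)"
proof -
  define ind where "ind i = (indicator (S i \<times> T i) :: real \<times> real \<Rightarrow> real)" for i
  \<comment> \<open>The sign makes the correlation of \<open>g i\<close> with \<open>W\<close> equal
    to the absolute deviation. Subtracting the average makes \<open>g i\<close> orthogonal to every
    function constant on the blocks of \<open>Q i\<close>.\<close>
  define g where "g i z = sgn (deviation (Q i) (S i) (T i)) * (ind i z - stepping (Q i) (ind i) z)" for i z
  define f where "f = stepping (Q n) W"
  define G where "G z = (\<Sum>i<n. g i z)" for z
  have refs: "refines {0..1} (Q j) (Q i)" if "i \<le> j" "j \<le> n" for i j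
    using that
  proof (induction j rule: dec_induct)
    case base
    then show ?case using fine_partitionD(2)[OF Q] by (intro refines_refl) auto
  next
    case (step j)
    then show ?case using ref[of j] refines_trans by (metis Suc_leD Suc_le_lessD)
  qed
  have ind_bc: "blockwise_constant (Q (Suc i)) (ind i)" if "i < n" for i
    unfolding ind_def using const[OF that] by (rule blockwise_constant_indicator)
  have step_bc: "blockwise_constant (Q j) (stepping (Q i) V)" if "i \<le> j" "j \<le> n" for i j V
    using that Q by (intro blockwise_constant_refine[OF refs[OF that]] blockwise_constant_stepping[OF Q]) auto
  have g_bc: "blockwise_constant (Q j) (g i)" if "i < j" "j \<le> n" for i j
  proof (rule blockwise_constant_refine[OF refs])
    show "blockwise_constant (Q (Suc i)) (g i)"
      unfolding g_def using that ind_bc step_bc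
      by (intro blockwise_constant_map2[where F = "\<lambda>u v. sgn (deviation (Q i) (S i) (T i)) * (u - v)"]) auto
  qed (use that in auto)
  have ind_int: "integrable square_measure (ind i)" if "i < n" for i
    using blockwise_constant_integrable[OF Q ind_bc[OF that]] that by simp
  have g_le: "\<bar>g i z\<bar> \<le> 1" if "i < n" "z \<in> unit_square" for i z
  proof -
    have "0 \<le> stepping (Q i) (ind i) z" "stepping (Q i) (ind i) z \<le> 1"
      unfolding ind_def using that S T Q by (auto intro!: stepping_indicator_bounds[OF Q \<eta>_pos])
    then have "\<bar>ind i z - stepping (Q i) (ind i) z\<bar> \<le> 1"
      by (auto simp: ind_def indicator_def)
    then show ?thesis by (auto simp: g_def abs_mult abs_sgn_eq)
  qed
  have g_meas: "g i \<in> borel_measurable square_measure" if "i < n" for i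
    using blockwise_constant_measurable[OF Q g_bc] that by blast
  have G_le: "\<bar>G z\<bar> \<le> real n" if "z \<in> unit_square" for z
    using sum_bounded_above[of "{..<n}" "\<lambda>i. \<bar>g i z\<bar>" 1] g_le that
    unfolding G_def by (auto intro: order_trans[OF sum_abs])
  have G_meas [measurable]: "G \<in> borel_measurable square_measure"
    unfolding G_def using g_meas by (intro borel_measurable_sum) auto
  have Wg: "\<theta> \<le> (LINT z|square_measure. f z * g i z)" if i: "i < n" for i
  proof -
    let ?s = "sgn (deviation (Q i) (S i) (T i))"
    have Qi: "fine_partition \<eta> (Q i)" and Qn: "fine_partition \<eta> (Q n)" using Q i by auto
    have m: "ind i \<in> borel_measurable square_measure" using ind_int[OF i] by auto
    obtain B where B: "\<And>z. z \<in> unit_square \<Longrightarrow> \<bar>stepping (Q i) (ind i) z\<bar> \<le> B"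
      using blockwise_constant_bounded[OF Qi blockwise_constant_stepping[OF Qi]] by blast
    have int1: "integrable square_measure (\<lambda>z. W z * ind i z)"
      by (rule integrable_mult_bounded[OF W_integrable m, of 1]) (auto simp: ind_def indicator_def)
    have int2: "integrable square_measure (\<lambda>z. W z * stepping (Q i) (ind i) z)"
      using integrable_stepping[OF Qi] B by (intro integrable_mult_bounded[OF W_integrable]) auto
    have int3: "integrable square_measure (\<lambda>z. stepping (Q i) W z * ind i z)"
      by (rule integrable_mult_bounded[OF integrable_stepping[OF Qi] m, of 1]) (auto simp: ind_def indicator_def)
    \<comment> \<open>All \<open>g i\<close> are constant on the blocks of the last partition, so
      its average \<open>f\<close> may be replaced by \<open>W\<close>.\<close>
    have "(LINT z|square_measure. f z * g i z) = (LINT z|square_measure. W z * g i z)"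
      unfolding f_def using integral_stepping_mult[OF Qn \<eta>_pos W_integrable g_bc] i by simp
    also have "\<dots> = (LINT z|square_measure. ?s * (W z * ind i z - W z * stepping (Q i) (ind i) z))"
      by (simp add: g_def algebra_simps)
    also have "\<dots> = ?s * ((LINT z|square_measure. W z * ind i z)
        - (LINT z|square_measure. W z * stepping (Q i) (ind i) z))"
      using int1 int2 by simp
    \<comment> \<open>Averaging is self-adjoint: it is moved from the indicator to \<open>W\<close>
      by way of the product of both averages.\<close>
    also have "(LINT z|square_measure. W z * stepping (Q i) (ind i) z)
        = (LINT z|square_measure. stepping (Q i) W z * stepping (Q i) (ind i) z)"
      by (intro integral_stepping_mult[OF Qi \<eta>_pos W_integrable] blockwise_constant_stepping[OF Qi])
    also have "\<dots> = (LINT z|square_measure. ind i z * stepping (Q i) W z)"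
      using integral_stepping_mult[OF Qi \<eta>_pos ind_int[OF i] blockwise_constant_stepping[OF Qi, of W]]
      by (simp add: mult.commute)
    also have "(LINT z|square_measure. W z * ind i z) - \<dots> = deviation (Q i) (S i) (T i)"
      using int1 int3 unfolding deviation_def rect_integral_def ind_def
      by (simp add: algebra_simps)
    also have "?s * deviation (Q i) (S i) (T i) = \<bar>deviation (Q i) (S i) (T i)\<bar>"
      by (simp add: abs_sgn mult.commute)
    finally show ?thesis using dev[OF i] by simp
  qed
  have gg_int: "integrable square_measure (\<lambda>z. g i z * g j z)" if "i < n" "j < n" for i j
    using that g_meas g_le
    by (intro integrable_mult_bounded[of _ _ 1] integrable_square_bounded[of _ 1]) auto
  have orth: "(LINT z|square_measure. g i z * g j z) = 0" if "i < j" "j < n" for i j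
  proof -
    let ?s = "sgn (deviation (Q j) (S j) (T j))"
    have Qj: "fine_partition \<eta> (Q j)" using Q that by auto
    have i1: "integrable square_measure (\<lambda>z. ind j z * g i z)"
      using that g_meas g_le ind_int by (intro integrable_mult_bounded[of _ _ 1]) auto
    have i2: "integrable square_measure (\<lambda>z. stepping (Q j) (ind j) z * g i z)"
      using that g_meas g_le integrable_stepping[OF Qj] by (intro integrable_mult_bounded[of _ _ 1]) auto
    have "(LINT z|square_measure. g i z * g j z)
        = (LINT z|square_measure. ?s * (ind j z * g i z - stepping (Q j) (ind j) z * g i z))"
      by (simp add: g_def[of j] algebra_simps)
    also have "\<dots> = ?s * ((LINT z|square_measure. ind j z * g i z)
        - (LINT z|square_measure. stepping (Q j) (ind j) z * g i z))"
      using i1 i2 by simp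
    \<comment> \<open>The earlier \<open>g i\<close> is constant on the blocks of
      \<open>Q j\<close>, so the indicator and its average over \<open>Q j\<close> have the same
      integral against it.\<close>
    also have "\<dots> = 0"
      using integral_stepping_mult[OF Qj \<eta>_pos ind_int g_bc] that by simp
    finally show ?thesis .
  qed
  have G2: "(LINT z|square_measure. (G z)\<^sup>2) \<le> real n"
  proof -
    have "(LINT z|square_measure. (G z)\<^sup>2) = (\<Sum>i<n. LINT z|square_measure. (g i z)\<^sup>2)"
      unfolding G_def by (rule integral_sum_square_orthogonal[OF gg_int orth])
    also have "\<dots> \<le> (\<Sum>i<n. 1)"
    proof (intro sum_mono)
      fix i assume "i \<in> {..<n}"
      then have i: "i < n" by simp
      have "(LINT z|square_measure. (g i z)\<^sup>2) \<le> (LINT z|square_measure. 1)"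
      proof (rule integral_mono)
        show "integrable square_measure (\<lambda>z. (g i z)\<^sup>2)"
          using gg_int[OF i i] by (simp add: power2_eq_square)
        show "(g i z)\<^sup>2 \<le> 1" if "z \<in> space square_measure" for z
          using g_le[OF i, of z] that by (simp add: abs_square_le_1)
      qed simp
      then show "(LINT z|square_measure. (g i z)\<^sup>2) \<le> 1" using square.prob_space by simp
    qed
    finally show ?thesis by simp
  qed
  have Qn: "fine_partition \<eta> (Q n)" using Q by simp
  have f_bc: "blockwise_constant (Q n) f" unfolding f_def by (rule blockwise_constant_stepping[OF Qn])
  have f_meas [measurable]: "f \<in> borel_measurable square_measure"
    by (rule blockwise_constant_measurable[OF Qn f_bc])
  have f_int: "integrable square_measure f"
    by (rule blockwise_constant_integrable[OF Qn f_bc])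
  obtain B where B: "\<And>z. z \<in> unit_square \<Longrightarrow> \<bar>f z\<bar> \<le> B"
    using blockwise_constant_bounded[OF Qn f_bc] by blast
  have fLp: "Lp_norm square_measure p f \<le> ennreal C"
    unfolding f_def by (rule Lp_norm_stepping[OF Qn])
  define K where "K = C * a powr (conjugate_exponent p - 1)"
  define t where "t = \<theta> - C / a"
  define u where "u z = (if \<bar>f z\<bar> > K then \<bar>f z\<bar> else 0)" for z
  define v where "v z = (if \<bar>f z\<bar> > K then 0 else (f z)\<^sup>2)" for z
  have tail: "(LINT z|square_measure. u z) \<le> C / a"
    using Lp_truncation(1)[OF C_pos p_gt_1 a fLp f_meas B] by (simp add: u_def K_def)
  have energy: "(LINT z|square_measure. v z) \<le> 2 * C\<^sup>2 * a powr (max 2 (conjugate_exponent p) - 2)"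
    using Lp_truncation(2)[OF C_pos p_gt_1 a fLp f_meas B] by (simp add: v_def K_def)
  have t: "t > 0" using \<theta> by (simp add: t_def)
  have u_int: "integrable square_measure u"
  proof (rule integrable_square_bounded)
    show "u \<in> borel_measurable square_measure" unfolding u_def by measurable
    show "\<bar>u z\<bar> \<le> \<bar>B\<bar>" if "z \<in> unit_square" for z using B[OF that] by (auto simp: u_def)
  qed
  have v_int: "integrable square_measure v"
  proof (rule integrable_square_bounded)
    show "v \<in> borel_measurable square_measure" unfolding v_def by measurable
    show "\<bar>v z\<bar> \<le> B\<^sup>2" if "z \<in> unit_square" for z
      using B[OF that] by (auto simp: v_def abs_le_square_iff[symmetric])
  qed
  have G2_int: "integrable square_measure (\<lambda>z. (G z)\<^sup>2)"
    by (rule integrable_square_bounded[of _ "(real n)\<^sup>2"]) (use G_le in \<open>auto simp: abs_le_square_iff[symmetric]\<close>)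
  have "real n * \<theta> = (\<Sum>i<n. \<theta>)" by simp
  also have "\<dots> \<le> (\<Sum>i<n. LINT z|square_measure. f z * g i z)"
    using Wg by (intro sum_mono) auto
  also have "\<dots> = (LINT z|square_measure. f z * G z)"
    unfolding G_def sum_distrib_left
    by (rule Bochner_Integration.integral_sum[symmetric])
       (use f_int g_meas g_le in \<open>auto intro!: integrable_mult_bounded[of _ _ 1]\<close>)
  also have "\<dots> \<le> (LINT z|square_measure. real n * u z + (v z / (2 * t) + t / 2 * (G z)\<^sup>2))"
  proof (rule integral_mono)
    show "integrable square_measure (\<lambda>z. f z * G z)"
      using f_int G_le by (intro integrable_mult_bounded[of _ _ "real n"]) auto
    show "integrable square_measure (\<lambda>z. real n * u z + (v z / (2 * t) + t / 2 * (G z)\<^sup>2))"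
      using u_int v_int G2_int by (intro Bochner_Integration.integrable_add integrable_mult_right integrable_divide)
    fix z assume "z \<in> space square_measure"
    then have Gz: "\<bar>G z\<bar> \<le> real n" using G_le by simp
    show "f z * G z \<le> real n * u z + (v z / (2 * t) + t / 2 * (G z)\<^sup>2)"
    proof (cases "\<bar>f z\<bar> > K")
      case True
      have "f z * G z \<le> \<bar>f z\<bar> * \<bar>G z\<bar>" by (metis abs_ge_self abs_mult)
      also have "\<dots> \<le> real n * \<bar>f z\<bar>" using mult_left_mono[OF Gz, of "\<bar>f z\<bar>"] by (simp add: mult.commute)
      finally show ?thesis using True t by (auto simp: u_def v_def intro: add_increasing2)
    next
      case False
      have "0 \<le> (f z - t * G z)\<^sup>2 / (2 * t)" using t by simp
      also have "\<dots> = (f z)\<^sup>2 / (2 * t) + t / 2 * (G z)\<^sup>2 - f z * G z"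
        using t by (simp add: power2_eq_square field_simps)
      finally show ?thesis using False by (simp add: u_def v_def)
    qed
  qed
  also have "\<dots> = real n * (LINT z|square_measure. u z)
      + ((LINT z|square_measure. v z) / (2 * t) + t / 2 * (LINT z|square_measure. (G z)\<^sup>2))"
    using u_int v_int G2_int by simp
  also have "\<dots> \<le> real n * (C / a)
      + (2 * C\<^sup>2 * a powr (max 2 (conjugate_exponent p) - 2) / (2 * t) + t / 2 * real n)"
    using tail energy G2 t by (intro add_mono mult_left_mono divide_right_mono) auto
  finally have "real n * \<theta> \<le> real n * (C / a)
      + (2 * C\<^sup>2 * a powr (max 2 (conjugate_exponent p) - 2) / (2 * t) + t / 2 * real n)" .
  moreover have "real n * \<theta> = real n * t + real n * (C / a)"
    by (simp add: t_def algebra_simps)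
  \<comment> \<open>After \<open>n * C / a\<close> cancels, \<open>n * t\<close> remains on the left
    and the bound on the square of \<open>G\<close> absorbs half of it. Multiplying by
    \<open>2 * t\<close> then gives the claim.\<close>
  ultimately have "real n * t / 2 \<le> 2 * C\<^sup>2 * a powr (max 2 (conjugate_exponent p) - 2) / (2 * t)"
    by (simp add: mult.commute)
  then show ?thesis
    using t unfolding t_def[symmetric] by (simp add: field_simps power2_eq_square)
qed

text \<open>Iterates \<open>refine_step\<close> from the trivial partition, using a bad rectangle at
  each stage. Only partitions that are still to be refined need at most \<open>4 powr N\<close>
  parts; the last one may have more.\<close>

lemma refinement_chain:
  assumes a: "a \<ge> 1" and \<eta>1: "\<eta> \<le> 1"
    and m: "2 * 4 powr N * \<eta> + 3 * \<eta> \<le> a powr (- conjugate_exponent p)"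
      "2 * 4 powr N * \<eta> + 6 * \<eta> \<le> 1"
    and bad: "\<And>P. fine_partition \<eta> P \<Longrightarrow> real (card P) \<le> 4 powr N \<Longrightarrow>
      \<exists>S T. S \<in> sets borel \<and> S \<subseteq> {0..1} \<and> T \<in> sets borel \<and> T \<subseteq> {0..1} \<and> \<theta> \<le> \<bar>deviation P S T\<bar>"
    and n: "real n \<le> N + 1"
  obtains Q S T where "\<And>i. i \<le> n \<Longrightarrow> fine_partition \<eta> (Q i)"
    "\<And>i. i < n \<Longrightarrow> refines {0..1} (Q (Suc i)) (Q i)"
    "\<And>i. i < n \<Longrightarrow> S i \<in> sets borel \<and> S i \<subseteq> {0..1}"
    "\<And>i. i < n \<Longrightarrow> T i \<in> sets borel \<and> T i \<subseteq> {0..1}"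
    "\<And>i J. i < n \<Longrightarrow> J \<in> Q (Suc i) \<Longrightarrow> J \<subseteq> S i \<or> J \<inter> S i = {}"
    "\<And>i J. i < n \<Longrightarrow> J \<in> Q (Suc i) \<Longrightarrow> J \<subseteq> T i \<or> J \<inter> T i = {}"
    "\<And>i. i < n \<Longrightarrow> \<theta> - 72 * C / a \<le> \<bar>deviation (Q i) (S i) (T i)\<bar>"
proof -
  define good where "good P P' S T \<longleftrightarrow> refines {0..1} P' P \<and>
      S \<in> sets borel \<and> S \<subseteq> {0..1} \<and> T \<in> sets borel \<and> T \<subseteq> {0..1} \<and>
      (\<forall>J\<in>P'. J \<subseteq> S \<or> J \<inter> S = {}) \<and> (\<forall>J\<in>P'. J \<subseteq> T \<or> J \<inter> T = {}) \<and>
      \<theta> - 72 * C / a \<le> \<bar>deviation P S T\<bar>" for P P' S T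
  \<comment> \<open>Dependent choice gives a sequence indexed by all naturals; from index
    \<open>n\<close> on the partition is just repeated.\<close>
  have "\<exists>Q. \<forall>i. (fine_partition \<eta> (Q i) \<and> card (Q i) \<le> 4 ^ i) \<and>
      (i < n \<longrightarrow> (\<exists>S T. good (Q i) (Q (Suc i)) S T))"
  proof (rule dependent_nat_choice)
    have "fine_partition \<eta> {{0..1}}"
      using \<eta>1 by (auto simp: fine_partition_def measurable_partition_def partition_on_def disjoint_def)
    then show "\<exists>P. fine_partition \<eta> P \<and> card P \<le> 4 ^ 0" by (intro exI[of _ "{{0..1}}"]) auto
  next
    fix P i assume P: "fine_partition \<eta> P \<and> card P \<le> 4 ^ i"
    show "\<exists>P'. (fine_partition \<eta> P' \<and> card P' \<le> 4 ^ Suc i) \<and> (i < n \<longrightarrow> (\<exists>S T. good P P' S T))"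
    proof (cases "i < n")
      case False
      then show ?thesis using P by (intro exI[of _ P]) auto
    next
      case True
      \<comment> \<open>A stage that is still refined has index at most \<open>n - 1\<close>, which
        is at most \<open>N\<close>.\<close>
      then have "real i \<le> N" using n by linarith
      have "real (card P) \<le> real (4 ^ i)" using P by (subst of_nat_le_iff) simp
      also have "\<dots> = 4 powr (real i)" by (simp add: powr_realpow)
      also have "\<dots> \<le> 4 powr N" using \<open>real i \<le> N\<close> by simp
      finally have card: "real (card P) \<le> 4 powr N" .
      then obtain S T where ST: "S \<in> sets borel" "S \<subseteq> {0..1}" "T \<in> sets borel" "T \<subseteq> {0..1}"
        "\<theta> \<le> \<bar>deviation P S T\<bar>" using bad[OF conjunct1[OF P] card] by (elim exE conjE)
      have "2 * real (card P) * \<eta> \<le> 2 * 4 powr N * \<eta>"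
        using card \<eta>_pos by (intro mult_right_mono) auto
      then have m': "2 * real (card P) * \<eta> + 3 * \<eta> \<le> a powr (- conjugate_exponent p)"
        "2 * real (card P) * \<eta> + 6 * \<eta> \<le> 1" using m by linarith+
      obtain P' S' T' where P': "fine_partition \<eta> P'" "refines {0..1} P' P" "card P' \<le> 4 * card P"
        "S' \<in> sets borel" "S' \<subseteq> {0..1}" "T' \<in> sets borel" "T' \<subseteq> {0..1}"
        "\<forall>J\<in>P'. J \<subseteq> S' \<or> J \<inter> S' = {}" "\<forall>J\<in>P'. J \<subseteq> T' \<or> J \<inter> T' = {}"
        "\<bar>deviation P S T - deviation P S' T'\<bar> \<le> 72 * C / a"
        using refine_step[OF conjunct1[OF P] a ST(1-4) m'] .
      have "good P P' S' T'" using P' ST(5) unfolding good_def by auto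
      moreover have "card P' \<le> 4 ^ Suc i" using P'(3) P by simp
      ultimately show ?thesis using P'(1) by blast
    qed
  qed
  then obtain Q where Q: "\<And>i. fine_partition \<eta> (Q i)"
    "\<And>i. i < n \<Longrightarrow> \<exists>S T. good (Q i) (Q (Suc i)) S T" by blast
  then obtain S T where "\<And>i. i < n \<Longrightarrow> good (Q i) (Q (Suc i)) (S i) (T i)" by metis
  then show thesis using Q(1) by (intro that[of Q S T]) (auto simp: good_def)
qed

end

section \<open>Choice of constants and contradiction\<close>

theorem theorem4p3:
  fixes C \<epsilon> N \<eta> :: real and p :: ennreal and W :: "real \<times> real \<Rightarrow> real"
  assumes "C > 0" and "p > 1" and "0 < \<epsilon>" and "\<epsilon> < 1"
    and "N = (6 / \<epsilon>) powr max 2 (conjugate_exponent p)"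
    and "\<eta> = 4 powr (- N - 1) * (\<epsilon> / 160) powr conjugate_exponent p"
    and "graphon W" and "upper_Lp_regular C \<eta> p W"
  shows "\<exists>P. measurable_partition P \<and> real (card P) \<le> 4 powr N \<and>
           (\<forall>J\<in>P. \<eta> \<le> measure lborel J) \<and>
           cut_norm (\<lambda>z. W z - stepping P W z) \<le> C * \<epsilon>"
proof (rule ccontr)
  assume contr: "\<not> ?thesis"
  have "\<eta> > 0" using assms by simp
  then interpret upper_regular_graphon C \<eta> p W
    using assms by unfold_locales
  define q where "q = conjugate_exponent p"
  define \<delta> where "\<delta> = (\<epsilon> / 160) powr q"
  \<comment> \<open>With this value \<open>a powr (- q)\<close> is the factor
    \<open>\<delta>\<close> of \<open>\<eta>\<close>, and the rounding loss
    \<open>72 * C / a\<close> is \<open>0.45 * C * \<epsilon>\<close>, less than half of the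
    deviation.\<close>
  define a where "a = 160 / \<epsilon>"
  have q: "q \<ge> 1" unfolding q_def by (rule conjugate_exponent_ge_1[OF assms(2)])
  have a: "a \<ge> 1" using assms by (simp add: a_def)
  have "\<delta> \<le> 1" unfolding \<delta>_def using assms q by (intro powr_le1) auto
  moreover have "a powr (- q) = \<delta>"
    using assms by (simp add: \<delta>_def a_def powr_minus powr_divide)
  moreover have "0 < \<delta>" using assms by (simp add: \<delta>_def)
  ultimately have \<delta>: "0 < \<delta>" "\<delta> \<le> 1" "a powr (- q) = \<delta>" by blast+
  have "1 powr max 2 q \<le> (6 / \<epsilon>) powr max 2 q"
    using assms by (intro powr_mono2) auto
  then have N: "N \<ge> 1" using assms(5) by (simp add: q_def)
  \<comment> \<open>The extra \<open>- 1\<close> in the exponent of \<open>\<eta>\<close> gives the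
    4 here. The strips then take \<open>\<delta> / 2\<close>, and since
    \<open>\<eta> \<le> \<delta> / 16\<close> the added multiples of \<open>\<eta>\<close> still fit
    below \<open>\<delta>\<close>.\<close>
  have \<eta>_eq: "4 powr N * \<eta> = \<delta> / 4"
    using assms(6) by (simp add: \<delta>_def q_def powr_diff powr_minus field_simps)
  have "4 powr 1 \<le> 4 powr N" using N by (intro powr_mono) auto
  then have "4 * \<eta> \<le> 4 powr N * \<eta>" using \<open>\<eta> > 0\<close> by (intro mult_right_mono) auto
  then have \<eta>_le: "\<eta> \<le> \<delta> / 16" using \<eta>_eq by simp
  have m: "2 * 4 powr N * \<eta> + 3 * \<eta> \<le> a powr (- conjugate_exponent p)"
    "2 * 4 powr N * \<eta> + 6 * \<eta> \<le> 1" "\<eta> \<le> 1"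
    using \<eta>_eq \<eta>_le \<delta> by (auto simp: q_def)
  have bad: "\<exists>S T. S \<in> sets borel \<and> S \<subseteq> {0..1} \<and> T \<in> sets borel \<and> T \<subseteq> {0..1} \<and> C * \<epsilon> \<le> \<bar>deviation P S T\<bar>"
    if P: "fine_partition \<eta> P" "real (card P) \<le> 4 powr N" for P
  proof (rule ccontr)
    assume neg: "\<not> ?thesis"
    have "cut_norm (\<lambda>z. W z - stepping P W z) \<le> C * \<epsilon>"
      unfolding cut_norm_def
    proof (rule cSUP_least)
      show "{S \<in> sets borel. S \<subseteq> {0..1::real}} \<times> {T \<in> sets borel. T \<subseteq> {0..1::real}} \<noteq> {}" by auto
      fix ST :: "real set \<times> real set"
      assume "ST \<in> {S \<in> sets borel. S \<subseteq> {0..1}} \<times> {T \<in> sets borel. T \<subseteq> {0..1}}"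
      then obtain S T where ST: "ST = (S, T)" "S \<in> sets borel" "S \<subseteq> {0..1}" "T \<in> sets borel" "T \<subseteq> {0..1}"
        by (cases ST) auto
      then have "\<bar>deviation P S T\<bar> \<le> C * \<epsilon>" using neg by (meson linear)
      then show "(case ST of (S, T) \<Rightarrow> \<bar>LINT z:(S \<times> T)|lborel. W z - stepping P W z\<bar>) \<le> C * \<epsilon>"
        using ST by (simp add: deviation_def set_integral_eq_rect_integral)
    qed
    then show False using contr P unfolding fine_partition_def by blast
  qed
  \<comment> \<open>The least natural number above \<open>N\<close>: long enough for a
    contradiction, yet with every refined index at most \<open>N\<close>.\<close>
  define n where "n = nat \<lfloor>N\<rfloor> + 1"
  have n: "N < real n" "real n \<le> N + 1" using N unfolding n_def by linarith+
  obtain Q S T where chain: "\<And>i. i \<le> n \<Longrightarrow> fine_partition \<eta> (Q i)"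
    "\<And>i. i < n \<Longrightarrow> refines {0..1} (Q (Suc i)) (Q i)"
    "\<And>i. i < n \<Longrightarrow> S i \<in> sets borel \<and> S i \<subseteq> {0..1}"
    "\<And>i. i < n \<Longrightarrow> T i \<in> sets borel \<and> T i \<subseteq> {0..1}"
    "\<And>i J. i < n \<Longrightarrow> J \<in> Q (Suc i) \<Longrightarrow> J \<subseteq> S i \<or> J \<inter> S i = {}"
    "\<And>i J. i < n \<Longrightarrow> J \<in> Q (Suc i) \<Longrightarrow> J \<subseteq> T i \<or> J \<inter> T i = {}"
    and dev: "\<And>i. i < n \<Longrightarrow> C * \<epsilon> - 72 * C / a \<le> \<bar>deviation (Q i) (S i) (T i)\<bar>"
    using refinement_chain[OF a m(3) m(1,2) bad n(2)] by blast
  have C\<epsilon>: "C * \<epsilon> > 0" using assms by simp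
  have "C * \<epsilon> / 2 \<le> C * \<epsilon> - 72 * C / a"
    using C\<epsilon> unfolding a_def by simp
  then have dev': "C * \<epsilon> / 2 \<le> \<bar>deviation (Q i) (S i) (T i)\<bar>" if "i < n" for i
    using dev[OF that] by linarith
  \<comment> \<open>The length bound is applied with a different truncation parameter,
    \<open>6 / \<epsilon>\<close>. It leaves \<open>C * \<epsilon> / 3\<close> of the correlation
    \<open>C * \<epsilon> / 2\<close> and turns the power on the right into
    \<open>N * \<epsilon>\<^sup>2 / 36\<close>, so that \<open>n \<le> N / 2\<close>, contradicting
    \<open>n > N\<close>.\<close>
  have "real n * (C * \<epsilon> / 2 - C / (6 / \<epsilon>))\<^sup>2
      \<le> 2 * C\<^sup>2 * (6 / \<epsilon>) powr (max 2 (conjugate_exponent p) - 2)"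
    by (rule refinement_chain_length[where n = n and Q = Q and S = S and T = T, OF chain dev']) (use assms C\<epsilon> in \<open>auto simp: field_simps\<close>)
  also have "(6 / \<epsilon>) powr (max 2 (conjugate_exponent p) - 2) = N * \<epsilon>\<^sup>2 / 36"
    using assms by (simp add: powr_diff power_divide)
  also have "C * \<epsilon> / 2 - C / (6 / \<epsilon>) = C * \<epsilon> / 3" by simp
  finally have "(C * \<epsilon>)\<^sup>2 * (real n / 9) \<le> (C * \<epsilon>)\<^sup>2 * (N / 18)"
    by (simp add: power_mult_distrib power_divide field_simps)
  then have "real n / 9 \<le> N / 18"
    using C\<epsilon> by (subst (asm) mult_le_cancel_left_pos) auto
  then show False using n N by linarith
qed

end
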